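(* Let $k\ge 1$ be an integer and let $e_\mu\in\hat\Gamma_{2k}$. Then the action of $e_\mu$ on elements $\vec v\in J_2^{S_{\Delta_{2k}}}$ (that is, $\vec v\mapsto\rho(e_\mu)\vec v$) is identical to that of some action $S_{1,\dots,k}$ or $i\cdot S_{1,\dots,k}$ on the entries of $\vec v$. Thus the set $\{[e_\mu]: e_\mu\in\hat\Gamma_{2k}\}$ of equivalence classes mod $\sim$ is isomorphic, as a set of actions on $J_2^{S_{\Delta_{2k}}}$, to the set $\{S_{1,\dots,k},\ i\cdot S_{1,\dots,k}: S_l\in\{A_{2^{l-1}},(1)\}\text{ for }1\le l\le k\}$; that is, sending a class $[e_\mu]$ to the map $\vec v\mapsto \rho(e_\mu)\vec v$ is a bijection from the set of classes onto this set of maps on $J_2^{S_{\Delta_{2k}}}$.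
   Context: Clifford algebra: $Cl(\mathbb{C}^{2k})$ is the unital associative complex algebra generated by $e_1,\dots,e_{2k}$ with $e_j^2=-1$ and $e_je_l=-e_le_j$ for $j\neq l$. For a finite sequence $\mu=(i_1,\dots,i_l)$ in $\{1,\dots,2k\}$ put $e_\mu=e_{i_1}\cdots e_{i_l}$, with $e_\emptyset=1$. $\hat\Gamma_{2k}$ is the multiplicative group consisting of the $2^{2k}$ elements $e_\mu$ with $\mu$ strictly increasing, together with their negatives. Representation: let $E_1=\begin{pmatrix} i&0\\0&-i\end{pmatrix}$, $E_2=\begin{pmatrix}0&i\\i&0\end{pmatrix}$, $B=\begin{pmatrix}0&-i\\i&0\end{pmatrix}$, and $I_2$ the $2\times2$ identity. The algebra isomorphism $\rho:Cl(\mathbb{C}^{2k})\to \mathrm{Mat}_{2^k}(\mathbb{C})$ is determined by $\rho(e_{2j-1})=I_2^{\otimes (k-j)}\otimes E_1\otimes B^{\otimes (j-1)}$ and $\rho(e_{2j})=I_2^{\otimes (k-j)}\otimes E_2\otimes B^{\otimes (j-1)}$ for $1\le j\le k$, where $\otimes$ is the Kronecker product (the block matrix $M\otimes N$ has blocks $m_{ab}N$). Torus: $S_{\Delta_{2k}}=\mathbb{C}^{2^k}/(\mathbb{Z}^{2^k}\oplus i\mathbb{Z}^{2^k})$, $J_2^{S_{\Delta_{2k}}}=\{x\in S_{\Delta_{2k}}:2x=0\}$; its elements are vectors of length $2^k$ with entries in $\{0,\frac12,\frac i2,\frac{1+i}2\}\subset\mathbb{C}/(\mathbb{Z}\oplus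 i\mathbb{Z})$. The matrices $\rho(e_\mu)$ have entries in $\mathbb{Z}[i]$ and act on $J_2^{S_{\Delta_{2k}}}$. Equivalence on $\hat\Gamma_{2k}$: $a\sim b$ iff $\rho(a)\vec v=\rho(b)\vec v$ for all $\vec v\in J_2^{S_{\Delta_{2k}}}$. Switch permutations: for $0\le j\le k-1$, divide $\{1,\dots,2^k\}$ into $2^{k-j}$ consecutive blocks of size $2^j$. $A_{2^j}$ is the permutation of $\{1,\dots,2^k\}$ interchanging the first and second blocks, the third and fourth blocks, etc., preserving order within each block. $(1)$ is the identity permutation. A permutation $\sigma$ of $\{1,\dots,2^k\}$ of order at most 2 acts on $J_2^{S_{\Delta_{2k}}}$ by $(\sigma\cdot\vec v)[m]=\vec v[\sigma(m)]$. $S_{1,\dots,k}$ denotes any map $S_k\circ\cdots\circ S_1$ with $S_l\in\{(1),A_{2^{l-1}}\}$ for $1\le l\le k$; $i\cdot S_{1,\dots,k}$ denotes such a map followed by scalar multiplication by $i$. *)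

theory Defs
  imports
    "HOL-Algebra.QuotRing"
    "HOL-Library.Poly_Mapping"
    "Jordan_Normal_Form.Matrix"
begin

text \<open>Words under concatenation form the free monoid, so that the type of finitely supported
  functions from words to complex numbers, with the convolution product of \<^theory>\<open>HOL-Library.Poly_Mapping\<close>,
  is the free associative algebra.\<close>

instantiation list :: (type) monoid_add
begin
definition zero_list :: "'a list" where "zero_list = []"
definition plus_list :: "'a list \<Rightarrow> 'a list \<Rightarrow> 'a list" where "plus_list = (@)"
instance by standard (simp_all add: zero_list_def plus_list_def)
end

definition free_alg :: "nat \<Rightarrow> (nat list \<Rightarrow>\<^sub>0 complex) ring" where
  "free_alg k = \<lparr>carrier = {f. \<forall>w\<in>Poly_Mapping.keys f. set w \<subseteq> {1..2*k}},
     monoid.mult = (*), one = 1, zero = 0, add = (+)\<rparr>"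

definition letter :: "nat \<Rightarrow> nat list \<Rightarrow>\<^sub>0 complex" where
  "letter j = Poly_Mapping.single [j] 1"

definition clifford_rels :: "nat \<Rightarrow> (nat list \<Rightarrow>\<^sub>0 complex) set" where
  "clifford_rels k =
     {letter j * letter j + 1 | j. j \<in> {1..2*k}} \<union>
     {letter j * letter l + letter l * letter j | j l. j \<in> {1..2*k} \<and> l \<in> {1..2*k} \<and> j \<noteq> l}"

definition clifford_ideal :: "nat \<Rightarrow> (nat list \<Rightarrow>\<^sub>0 complex) set" where
  "clifford_ideal k = Idl\<^bsub>free_alg k\<^esub> (clifford_rels k)"

definition clifford :: "nat \<Rightarrow> (nat list \<Rightarrow>\<^sub>0 complex) set ring" where
  "clifford k = free_alg k Quot clifford_ideal k"

definition clifford_class :: "nat \<Rightarrow> (nat list \<Rightarrow>\<^sub>0 complex) \<Rightarrow> (nat list \<Rightarrow>\<^sub>0 complex) set" where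
  "clifford_class k f = clifford_ideal k +>\<^bsub>free_alg k\<^esub> f"

definition gen :: "nat \<Rightarrow> nat \<Rightarrow> (nat list \<Rightarrow>\<^sub>0 complex) set" where
  "gen k j = clifford_class k (letter j)"

definition gen_prod :: "nat \<Rightarrow> nat list \<Rightarrow> (nat list \<Rightarrow>\<^sub>0 complex) set" where
  "gen_prod k \<mu> = foldr (\<lambda>j a. gen k j \<otimes>\<^bsub>clifford k\<^esub> a) \<mu> \<one>\<^bsub>clifford k\<^esub>"

definition Gamma_hat :: "nat \<Rightarrow> (nat list \<Rightarrow>\<^sub>0 complex) set monoid" where
  "Gamma_hat k =
     \<lparr>carrier =
        {gen_prod k \<mu> | \<mu>. sorted_wrt (<) \<mu> \<and> set \<mu> \<subseteq> {1..2*k}} \<union>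
        {\<ominus>\<^bsub>clifford k\<^esub> gen_prod k \<mu> | \<mu>. sorted_wrt (<) \<mu> \<and> set \<mu> \<subseteq> {1..2*k}},
      monoid.mult = monoid.mult (clifford k), one = one (clifford k)\<rparr>"

definition E1 :: "complex mat" where
  "E1 = mat_of_rows_list 2 [[\<i>, 0], [0, - \<i>]]"

definition E2 :: "complex mat" where
  "E2 = mat_of_rows_list 2 [[0, \<i>], [\<i>, 0]]"

definition Bmat :: "complex mat" where
  "Bmat = mat_of_rows_list 2 [[0, - \<i>], [\<i>, 0]]"

definition kron :: "complex mat \<Rightarrow> complex mat \<Rightarrow> complex mat" (infixr \<open>\<otimes>\<^sub>K\<close> 70) where
  "M \<otimes>\<^sub>K N = mat (dim_row M * dim_row N) (dim_col M * dim_col N)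
     (\<lambda>(r, c). M $$ (r div dim_row N, c div dim_col N) * N $$ (r mod dim_row N, c mod dim_col N))"

fun kron_pow :: "complex mat \<Rightarrow> nat \<Rightarrow> complex mat" where
  "kron_pow M 0 = 1\<^sub>m 1"
| "kron_pow M (Suc n) = M \<otimes>\<^sub>K kron_pow M n"

text \<open>Generator number \<open>i\<close> is the one of index \<open>2*j-1\<close> or \<open>2*j\<close>.\<close>

definition gen_mat :: "nat \<Rightarrow> nat \<Rightarrow> complex mat" where
  "gen_mat k i =
     (let j = (i + 1) div 2
      in kron_pow (1\<^sub>m 2) (k - j) \<otimes>\<^sub>K (if odd i then E1 else E2) \<otimes>\<^sub>K kron_pow Bmat (j - 1))"

definition mat_alg :: "nat \<Rightarrow> complex mat ring" where
  "mat_alg k = ring_mat TYPE(complex) (2^k) ()"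

definition word_mat :: "nat \<Rightarrow> nat list \<Rightarrow> complex mat" where
  "word_mat k w = foldr (\<lambda>j M. gen_mat k j * M) w (1\<^sub>m (2^k))"

definition free_eval :: "nat \<Rightarrow> (nat list \<Rightarrow>\<^sub>0 complex) \<Rightarrow> complex mat" where
  "free_eval k f =
     (\<Oplus>\<^bsub>mat_alg k\<^esub>w\<in>Poly_Mapping.keys f. Poly_Mapping.lookup f w \<cdot>\<^sub>m word_mat k w)"

text \<open>An element of the Clifford algebra is a coset, on which evaluation is
  constant (\<open>rho_class\<close>); the resulting map is the unital algebra homomorphism with the prescribed
  values on generators (\<open>rho_hom\<close>, \<open>rho_scalar\<close>, \<open>rho_gen\<close>).\<close>

definition rho :: "nat \<Rightarrow> (nat list \<Rightarrow>\<^sub>0 complex) set \<Rightarrow> complex mat" where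
  "rho k a = the_elem (free_eval k ` a)"

text \<open>Vector entries are indexed from 0, as in \<^theory>\<open>Jordan_Normal_Form.Matrix\<close>.\<close>

definition vec_space :: "nat \<Rightarrow> (complex, complex vec) module" where
  "vec_space k = module_vec TYPE(complex) (2^k)"

definition gauss_lattice :: "nat \<Rightarrow> complex vec set" where
  "gauss_lattice k = {v \<in> carrier_vec (2^k). \<forall>m<2^k. Re (v $ m) \<in> \<int> \<and> Im (v $ m) \<in> \<int>}"

definition torus :: "nat \<Rightarrow> complex vec set monoid" where
  "torus k = A_FactGroup (vec_space k) (gauss_lattice k)"

text \<open>The operation of the quotient group, induced by addition of vectors, is written
  multiplicatively.\<close>

definition J2 :: "nat \<Rightarrow> complex vec set set" where
  "J2 k = {v \<in> carrier (torus k). v \<otimes>\<^bsub>torus k\<^esub> v = \<one>\<^bsub>torus k\<^esub>}"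

text \<open>The map that an additive map \<open>f\<close> preserving the lattice induces on the torus
  (\<open>torus_map_coset\<close>).\<close>

definition torus_map :: "nat \<Rightarrow> (complex vec \<Rightarrow> complex vec) \<Rightarrow> complex vec set \<Rightarrow> complex vec set" where
  "torus_map k f v = (\<Union>x\<in>v. gauss_lattice k +>\<^bsub>vec_space k\<^esub> f x)"

definition clifford_act ::
    "nat \<Rightarrow> (nat list \<Rightarrow>\<^sub>0 complex) set \<Rightarrow> complex vec set \<Rightarrow> complex vec set" where
  "clifford_act k a = torus_map k (\<lambda>x. rho k a *\<^sub>v x)"

definition act_equiv ::
    "nat \<Rightarrow> ((nat list \<Rightarrow>\<^sub>0 complex) set \<times> (nat list \<Rightarrow>\<^sub>0 complex) set) set" where
  "act_equiv k = {(a, b). a \<in> carrier (Gamma_hat k) \<and> b \<in> carrier (Gamma_hat k) \<and>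
     (\<forall>v\<in>J2 k. clifford_act k a v = clifford_act k b v)}"

text \<open>\<open>switch_perm k b\<close> interchanges consecutive blocks of size \<open>b\<close> of \<open>{0..<2^k}\<close> in pairs.\<close>

definition switch_perm :: "nat \<Rightarrow> nat \<Rightarrow> nat \<Rightarrow> nat" where
  "switch_perm k b m =
     (if m < 2^k then if even (m div b) then m + b else m - b else m)"

definition perm_act :: "nat \<Rightarrow> (nat \<Rightarrow> nat) \<Rightarrow> complex vec set \<Rightarrow> complex vec set" where
  "perm_act k \<sigma> = torus_map k (\<lambda>x. vec (2^k) (\<lambda>m. x $ \<sigma> m))"

definition i_act :: "nat \<Rightarrow> complex vec set \<Rightarrow> complex vec set" where
  "i_act k = torus_map k (\<lambda>x. \<i> \<cdot>\<^sub>v x)"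

fun perm_chain :: "nat \<Rightarrow> (nat \<Rightarrow> nat \<Rightarrow> nat) \<Rightarrow> nat \<Rightarrow> complex vec set \<Rightarrow> complex vec set" where
  "perm_chain k \<sigma> 0 = id"
| "perm_chain k \<sigma> (Suc l) = perm_act k (\<sigma> (Suc l)) \<circ> perm_chain k \<sigma> l"

definition switch_maps :: "nat \<Rightarrow> (complex vec set \<Rightarrow> complex vec set) set" where
  "switch_maps k =
     {perm_chain k \<sigma> k | \<sigma>. \<forall>l\<in>{1..k}. \<sigma> l \<in> {id, switch_perm k (2^(l - 1))}}"

text \<open>Restriction makes two maps on \<open>J2 k\<close> equal precisely when they agree there.\<close>

definition switch_actions :: "nat \<Rightarrow> (complex vec set \<Rightarrow> complex vec set) set" where
  "switch_actions k =
     {restrict S (J2 k) | S. S \<in> switch_maps k} \<union>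
     {restrict (i_act k \<circ> S) (J2 k) | S. S \<in> switch_maps k}"


lemma kron_dim [simp]: "dim_row (M \<otimes>\<^sub>K N) = dim_row M * dim_row N" "dim_col (M \<otimes>\<^sub>K N) = dim_col M * dim_col N"
  by (simp_all add: kron_def)

lemma kron_index: "r < dim_row M * dim_row N \<Longrightarrow> c < dim_col M * dim_col N \<Longrightarrow>
  (M \<otimes>\<^sub>K N) $$ (r, c) = M $$ (r div dim_row N, c div dim_col N) * N $$ (r mod dim_row N, c mod dim_col N)"
  by (simp add: kron_def)

lemma sum_div_mod:
  fixes f :: "nat \<Rightarrow> nat \<Rightarrow> complex"
  shows "(\<Sum>i<m*n. f (i div n) (i mod n)) = (\<Sum>i<m. \<Sum>j<n. f i j)"
proof (cases "n = 0")
  case False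
  have *: "i * n + j < m * n" if "i < m" "j < n" for i j
  proof -
    have "i * n + j < Suc i * n" using that by simp
    also have "\<dots> \<le> m * n" using that by (intro mult_le_mono1) auto
    finally show ?thesis .
  qed
  show ?thesis unfolding sum.cartesian_product
    by (rule sum.reindex_bij_witness[where i="\<lambda>(i,j). i*n+j" and j="\<lambda>i. (i div n, i mod n)"])
      (use False in \<open>auto simp: less_mult_imp_div_less mult.commute intro: *\<close>)
qed simp

lemma div_less_dim: "r < a * (b::nat) \<Longrightarrow> r div b < a \<and> r mod b < b"
  by (metis less_mult_imp_div_less mod_less_divisor mult_0_right not_less_zero neq0_conv)

lemma kron_mult:
  assumes "dim_col A = dim_row C" "dim_col B = dim_row D"
  shows "(A \<otimes>\<^sub>K B) * (C \<otimes>\<^sub>K D) = (A * C) \<otimes>\<^sub>K (B * D)"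
proof (rule eq_matI)
  fix i j assume "i < dim_row ((A * C) \<otimes>\<^sub>K (B * D))" "j < dim_col ((A * C) \<otimes>\<^sub>K (B * D))"
  then have ij: "i < dim_row A * dim_row B" "j < dim_col C * dim_col D" by auto
  note d = div_less_dim[OF ij(1)] div_less_dim[OF ij(2)]
  have "((A \<otimes>\<^sub>K B) * (C \<otimes>\<^sub>K D)) $$ (i,j) =
     (\<Sum>l<dim_row C * dim_row D. (A \<otimes>\<^sub>K B) $$ (i,l) * (C \<otimes>\<^sub>K D) $$ (l,j))"
    using ij assms by (simp add: scalar_prod_def atLeast0LessThan)
  also have "\<dots> = (\<Sum>l<dim_row C * dim_row D. (A $$ (i div dim_row B, l div dim_row D) * B $$ (i mod dim_row B, l mod dim_row D))
     * (C $$ (l div dim_row D, j div dim_col D) * D $$ (l mod dim_row D, j mod dim_col D)))"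
    using ij assms by (intro sum.cong) (auto simp: kron_index)
  also have "\<dots> = (\<Sum>l<dim_row C. \<Sum>m<dim_row D. (A $$ (i div dim_row B, l) * B $$ (i mod dim_row B, m))
     * (C $$ (l, j div dim_col D) * D $$ (m, j mod dim_col D)))"
    by (rule sum_div_mod)
  also have "\<dots> = (A * C) $$ (i div dim_row B, j div dim_col D) * (B * D) $$ (i mod dim_row B, j mod dim_col D)"
    using d assms by (simp add: scalar_prod_def atLeast0LessThan sum_product algebra_simps)
  finally show "((A \<otimes>\<^sub>K B) * (C \<otimes>\<^sub>K D)) $$ (i,j) = ((A * C) \<otimes>\<^sub>K (B * D)) $$ (i,j)"
    using ij by (simp add: kron_index)
qed auto

lemma kron_uminus: "(- A) \<otimes>\<^sub>K B = - (A \<otimes>\<^sub>K B)" "A \<otimes>\<^sub>K (- B) = - (A \<otimes>\<^sub>K B)"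
  by (auto intro!: eq_matI simp: kron_index dest!: div_less_dim)

lemma kron_one: "1\<^sub>m a \<otimes>\<^sub>K 1\<^sub>m b = 1\<^sub>m (a * b)"
proof (rule eq_matI, goal_cases)
  case (1 i j)
  then show ?case by (auto simp: kron_index dest!: div_less_dim) (metis div_mult_mod_eq)
qed auto

lemma kron_assoc: "(A \<otimes>\<^sub>K B) \<otimes>\<^sub>K C = A \<otimes>\<^sub>K (B \<otimes>\<^sub>K C)"
proof (rule eq_matI, goal_cases)
  case (1 i j)
  then have ij: "i < dim_row A * dim_row B * dim_row C" "j < dim_col A * dim_col B * dim_col C"
    by (auto simp: ac_simps)
  note d = div_less_dim[OF ij(1)] div_less_dim[OF ij(2)]
  have "i < dim_row A * (dim_row B * dim_row C)" "j < dim_col A * (dim_col B * dim_col C)" using ij by (simp_all add: ac_simps)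
  note e = div_less_dim[OF this(1)] div_less_dim[OF this(2)]
  have m: "i mod (b * c) div c = i div c mod b" "i mod (b*c) mod c = i mod c"
     "i div (b*c) = i div c div b" for i b c :: nat
    by (cases "c = 0"; simp add: mod_mult2_eq mult.commute[of b c])
      (simp_all add: mod_mult2_eq div_mult2_eq mult.commute[of b c])
  show ?case using ij d e by (simp add: kron_index m ac_simps)
qed (auto simp: ac_simps)


lemma E1_carrier [simp]: "E1 \<in> carrier_mat 2 2" and E2_carrier [simp]: "E2 \<in> carrier_mat 2 2"
  and B_carrier [simp]: "Bmat \<in> carrier_mat 2 2"
  by (auto simp: E1_def E2_def Bmat_def mat_of_rows_list_def intro!: carrier_matI)

lemma pauli_index [simp]:
  "E1 $$ (0,0) = \<i>" "E1 $$ (0,Suc 0) = 0" "E1 $$ (Suc 0,0) = 0" "E1 $$ (Suc 0,Suc 0) = - \<i>"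
  "E2 $$ (0,0) = 0" "E2 $$ (0,Suc 0) = \<i>" "E2 $$ (Suc 0,0) = \<i>" "E2 $$ (Suc 0,Suc 0) = 0"
  "Bmat $$ (0,0) = 0" "Bmat $$ (0,Suc 0) = - \<i>" "Bmat $$ (Suc 0,0) = \<i>" "Bmat $$ (Suc 0,Suc 0) = 0"
  by (simp_all add: E1_def E2_def Bmat_def mat_of_rows_list_def)

lemma mat2_eqI:
  assumes "A \<in> carrier_mat 2 2" "B \<in> carrier_mat 2 2"
  "A $$ (0,0) = B $$ (0,0)" "A $$ (0,1) = B $$ (0,1)" "A $$ (1,0) = B $$ (1,0)" "A $$ (1,1) = B $$ (1,1)"
  shows "A = B"
  by (rule eq_matI) (use assms in \<open>auto simp: less_2_cases_iff\<close>)

lemma pauli: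
  "E1 * E1 = - 1\<^sub>m 2" "E2 * E2 = - 1\<^sub>m 2" "Bmat * Bmat = 1\<^sub>m 2" "E1 * E2 = - (E2 * E1)"
  "E1 * Bmat = - (Bmat * E1)" "E2 * Bmat = - (Bmat * E2)"
  using carrier_matD[OF E1_carrier] carrier_matD[OF E2_carrier] carrier_matD[OF B_carrier]
  by - (rule mat2_eqI; (intro mult_carrier_mat[where n=2] uminus_carrier_mat one_carrier_mat E1_carrier E2_carrier B_carrier | simp add: scalar_prod_def numeral_2_eq_2))+

lemma kron_carrier [simp]: "M \<in> carrier_mat a b \<Longrightarrow> N \<in> carrier_mat c d \<Longrightarrow> M \<otimes>\<^sub>K N \<in> carrier_mat (a*c) (b*d)"
  by (auto intro!: carrier_matI)

lemma kron_pow_carrier [simp]: "M \<in> carrier_mat 2 2 \<Longrightarrow> kron_pow M n \<in> carrier_mat (2^n) (2^n)"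
  by (induct n) (auto intro!: carrier_matI)

lemma kron_pow_one: "kron_pow (1\<^sub>m 2) n = 1\<^sub>m (2^n)"
  by (induct n) (auto simp: kron_one)

lemma kron_pow_B_sq: "kron_pow Bmat n * kron_pow Bmat n = 1\<^sub>m (2^n)"
proof (induct n)
  case (Suc n)
  have [simp]: "dim_row (kron_pow Bmat n) = 2^n" "dim_col (kron_pow Bmat n) = 2^n"
    "dim_row Bmat = 2" "dim_col Bmat = 2"
    using carrier_matD[OF kron_pow_carrier[OF B_carrier, of n]] carrier_matD[OF B_carrier] by auto
  show ?case by (simp add: kron_mult Suc pauli kron_one)
qed auto

lemma kron_one1: "1\<^sub>m 1 \<otimes>\<^sub>K M = M"
  by (rule eq_matI) (auto simp: kron_index)

lemma gen_mat_carrier [simp]: 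
  assumes "i \<in> {1..2*k}" shows "gen_mat k i \<in> carrier_mat (2^k) (2^k)"
proof -
  define j where "j = (i + 1) div 2"
  have "(2::nat)^k = 2^(k-j) * (2 * 2^(j-1))" 
  proof -
    have "k = (k - j) + Suc (j - 1)" using assms unfolding j_def by auto
    then show ?thesis by (metis power_add power_Suc)
  qed
  then show ?thesis unfolding gen_mat_def Let_def j_def[symmetric]
    by (auto intro!: kron_carrier)
qed

lemma gen_mat_Suc:
  assumes "i \<in> {1..2*k}" shows "gen_mat (Suc k) i = 1\<^sub>m 2 \<otimes>\<^sub>K gen_mat k i"
proof -
  have "Suc k - (i+1) div 2 = Suc (k - (i+1) div 2)" using assms by auto
  then show ?thesis by (simp add: gen_mat_def Let_def kron_assoc)
qed

lemma gen_mat_new: "gen_mat (Suc k) (2*k+1) = E1 \<otimes>\<^sub>K kron_pow Bmat k"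
  "gen_mat (Suc k) (2*k+2) = E2 \<otimes>\<^sub>K kron_pow Bmat k"
  by (simp_all add: gen_mat_def kron_one1[simplified])

lemma uminus_uminus_mat: "- (- A) = (A :: complex mat)" by auto

lemma B_anti:
  assumes "i \<in> {1..2*k}"
  shows "gen_mat k i * kron_pow Bmat k = - (kron_pow Bmat k * gen_mat k i)"
  using assms
proof (induct k)
  case (Suc k)
  note dims = carrier_matD[OF kron_pow_carrier[OF B_carrier, of k]] carrier_matD[OF B_carrier]
    carrier_matD[OF E1_carrier] carrier_matD[OF E2_carrier]
  from Suc.prems consider "i \<in> {1..2*k}" | "i = 2*k+1" | "i = 2*k+2" by force
  then show ?case
  proof cases
    case 1
    note d = carrier_matD[OF gen_mat_carrier[OF 1]]
    show ?thesis by (simp add: gen_mat_Suc[OF 1] kron_mult Suc.hyps[OF 1] dims d kron_uminus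
        B_carrier[THEN left_mult_one_mat] B_carrier[THEN right_mult_one_mat])
  next
    case 2
    then show ?thesis by (simp only: gen_mat_new kron_pow.simps) (simp add: kron_mult dims kron_pow_B_sq pauli kron_uminus)
  next
    case 3
    then show ?thesis by (simp only: gen_mat_new kron_pow.simps) (simp add: kron_mult dims kron_pow_B_sq pauli kron_uminus)
  qed
qed auto

lemma gen_mat_rels:
  assumes "i \<in> {1..2*k}" "j \<in> {1..2*k}"
  shows "gen_mat k i * gen_mat k j = (if i = j then - 1\<^sub>m (2^k) else - (gen_mat k j * gen_mat k i))"
  using assms
proof (induct k arbitrary: i j)
  case (Suc k)
  note dims = carrier_matD[OF kron_pow_carrier[OF B_carrier, of k]] carrier_matD[OF B_carrier]
    carrier_matD[OF E1_carrier] carrier_matD[OF E2_carrier]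
  note one = B_carrier[THEN left_mult_one_mat] B_carrier[THEN right_mult_one_mat]
    E1_carrier[THEN left_mult_one_mat] E1_carrier[THEN right_mult_one_mat]
    E2_carrier[THEN left_mult_one_mat] E2_carrier[THEN right_mult_one_mat]
  have mixed: "gen_mat (Suc k) i * gen_mat (Suc k) j = - (gen_mat (Suc k) j * gen_mat (Suc k) i)"
    if i: "i \<in> {1..2*k}" and j: "j = 2*k+1 \<or> j = 2*k+2" for i j
    using j
  proof
    note d = carrier_matD[OF gen_mat_carrier[OF i]]
    assume j: "j = 2*k+1"
    show ?thesis unfolding j gen_mat_new gen_mat_Suc[OF i]
      by (simp add: kron_mult dims d B_anti[OF i] kron_uminus one)
  next
    note d = carrier_matD[OF gen_mat_carrier[OF i]]
    assume j: "j = 2*k+2"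
    show ?thesis unfolding j gen_mat_new gen_mat_Suc[OF i]
      by (simp add: kron_mult dims d B_anti[OF i] kron_uminus one)
  qed
  have new: "gen_mat (Suc k) i * gen_mat (Suc k) j = (if i = j then - 1\<^sub>m (2^Suc k) else - (gen_mat (Suc k) j * gen_mat (Suc k) i))"
    if "i = 2*k+1 \<or> i = 2*k+2" "j = 2*k+1 \<or> j = 2*k+2" for i j
    using that apply (elim disjE; simp only: gen_mat_new)
    by (auto simp add: kron_mult dims kron_pow_B_sq pauli kron_uminus kron_one uminus_uminus_mat)
  consider "i \<in> {1..2*k}" "j \<in> {1..2*k}" | "i \<in> {1..2*k}" "j = 2*k+1 \<or> j = 2*k+2"
   | "j \<in> {1..2*k}" "i = 2*k+1 \<or> i = 2*k+2" | "i = 2*k+1 \<or> i = 2*k+2" "j = 2*k+1 \<or> j = 2*k+2"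
    using Suc.prems by force
  then show ?case
  proof cases
    case 1
    note d = carrier_matD[OF gen_mat_carrier[OF 1(1)]] carrier_matD[OF gen_mat_carrier[OF 1(2)]]
    show ?thesis by (simp add: gen_mat_Suc[OF 1(1)] gen_mat_Suc[OF 1(2)] kron_mult d Suc.hyps[OF 1] kron_uminus kron_one)
  next
    case 2 show ?thesis using mixed[OF 2] 2 by auto
  next
    case 3 show ?thesis using mixed[OF 3] 3 by (auto simp: uminus_uminus_mat)
  next
    case 4 show ?thesis using new[OF 4] .
  qed
qed auto


lemma free_alg_simps:
  "carrier (free_alg k) = {f. \<forall>w\<in>Poly_Mapping.keys f. set w \<subseteq> {1..2*k}}"
  "monoid.mult (free_alg k) = (*)" "one (free_alg k) = 1" "zero (free_alg k) = 0" "add (free_alg k) = (+)"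
  by (simp_all add: free_alg_def)

lemma ring_free_alg: "ring (free_alg k)"
proof (rule ringI)
  show "abelian_group (free_alg k)"
  proof (rule abelian_groupI)
    fix x y assume "x \<in> carrier (free_alg k)" "y \<in> carrier (free_alg k)"
    then show "x \<oplus>\<^bsub>free_alg k\<^esub> y \<in> carrier (free_alg k)"
      using Poly_Mapping.keys_add[of x y] by (auto simp: free_alg_simps)
  next
    fix x assume "x \<in> carrier (free_alg k)"
    then show "\<exists>y\<in>carrier (free_alg k). y \<oplus>\<^bsub>free_alg k\<^esub> x = \<zero>\<^bsub>free_alg k\<^esub>"
      by (intro bexI[of _ "- x"]) (auto simp: free_alg_simps in_keys_iff)
  qed (auto simp: free_alg_simps algebra_simps)
  show "Group.monoid (free_alg k)"
  proof (rule monoidI)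
    fix x y assume "x \<in> carrier (free_alg k)" "y \<in> carrier (free_alg k)"
    then show "x \<otimes>\<^bsub>free_alg k\<^esub> y \<in> carrier (free_alg k)"
      using Poly_Mapping.keys_mult[of x y] by (fastforce simp: free_alg_simps plus_list_def)
  qed (auto simp: free_alg_simps algebra_simps zero_list_def)
qed (auto simp: free_alg_simps algebra_simps)

lemma ring_mat_alg: "ring (mat_alg k)"
  unfolding mat_alg_def by (rule ring_mat)

lemmas mat_alg_simps = ring_mat_simps[of "TYPE(complex)" "2^k" "()" for k, folded mat_alg_def]

lemma word_mat_carrier: "set w \<subseteq> {1..2*k} \<Longrightarrow> word_mat k w \<in> carrier_mat (2^k) (2^k)"
  by (induct w) (auto simp: word_mat_def intro!: mult_carrier_mat[where n="2^k"] gen_mat_carrier)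

lemma word_mat_append: "set v \<subseteq> {1..2*k} \<Longrightarrow> set w \<subseteq> {1..2*k} \<Longrightarrow>
  word_mat k (v @ w) = word_mat k v * word_mat k w"
proof (induct v)
  case Nil
  then show ?case using word_mat_carrier[of w k] by (simp add: word_mat_def)
next
  case (Cons a v)
  have "word_mat k (a # v @ w) = gen_mat k a * word_mat k (v @ w)" by (simp add: word_mat_def)
  also have "\<dots> = gen_mat k a * word_mat k v * word_mat k w"
    using Cons by (simp add: assoc_mult_mat[OF gen_mat_carrier word_mat_carrier word_mat_carrier])
  finally show ?case by (simp add: word_mat_def)
qed

lemma finsum_mat_alg:
  assumes "finite A" "\<And>w. w \<in> A \<Longrightarrow> F w \<in> carrier_mat (2^k) (2^k)"
  shows "(\<Oplus>\<^bsub>mat_alg k\<^esub>w\<in>A. F w) = mat (2^k) (2^k) (\<lambda>ij. \<Sum>w\<in>A. F w $$ ij)"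
  using assms
proof (induct A)
  case empty
  interpret ring "mat_alg k" by (rule ring_mat_alg)
  show ?case by (auto simp: mat_alg_simps)
next
  case (insert x A)
  interpret ring "mat_alg k" by (rule ring_mat_alg)
  have "(\<Oplus>\<^bsub>mat_alg k\<^esub>w\<in>insert x A. F w) = F x + (\<Oplus>\<^bsub>mat_alg k\<^esub>w\<in>A. F w)"
    using insert by (subst finsum_insert) (auto simp: mat_alg_simps)
  also have "\<dots> = F x + mat (2^k) (2^k) (\<lambda>ij. \<Sum>w\<in>A. F w $$ ij)" using insert by simp
  also have "\<dots> = mat (2^k) (2^k) (\<lambda>ij. \<Sum>w\<in>insert x A. F w $$ ij)"
    using insert by (intro eq_matI) auto
  finally show ?case .
qed

lemma free_eval_super:
  assumes "finite A" "Poly_Mapping.keys f \<subseteq> A" "\<And>w. w \<in> A \<Longrightarrow> set w \<subseteq> {1..2*k}"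
  shows "free_eval k f = mat (2^k) (2^k) (\<lambda>ij. \<Sum>w\<in>A. Poly_Mapping.lookup f w * word_mat k w $$ ij)"
proof -
  have "free_eval k f = mat (2^k) (2^k) (\<lambda>ij. \<Sum>w\<in>Poly_Mapping.keys f. (Poly_Mapping.lookup f w \<cdot>\<^sub>m word_mat k w) $$ ij)"
    unfolding free_eval_def using assms(2,3)
    by (intro finsum_mat_alg finite_keys smult_carrier_mat word_mat_carrier) blast
  also have "\<dots> = mat (2^k) (2^k) (\<lambda>ij. \<Sum>w\<in>A. Poly_Mapping.lookup f w * word_mat k w $$ ij)"
  proof (rule eq_matI, goal_cases)
    case (1 i j)
    have "word_mat k w \<in> carrier_mat (2^k) (2^k)" if "w \<in> A" for w
      using word_mat_carrier[OF assms(3)[OF that]] .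
    then have "i < dim_row (word_mat k w)" "j < dim_col (word_mat k w)" if "w \<in> A" for w
      using 1 that by (metis carrier_matD dim_row_mat(1) dim_col_mat(1))+
    then have "(\<Sum>w\<in>Poly_Mapping.keys f. (Poly_Mapping.lookup f w \<cdot>\<^sub>m word_mat k w) $$ (i,j)) =
     (\<Sum>w\<in>Poly_Mapping.keys f. Poly_Mapping.lookup f w * word_mat k w $$ (i,j))"
      using 1 assms(2) by (intro sum.cong refl) (subst index_smult_mat, auto)
    also have "\<dots> = (\<Sum>w\<in>A. Poly_Mapping.lookup f w * word_mat k w $$ (i,j))"
      using assms by (intro sum.mono_neutral_left) (auto simp: in_keys_iff)
    finally show ?case using 1 by simp
  qed auto
  finally show ?thesis .
qed

lemma free_eval_carrier: "f \<in> carrier (free_alg k) \<Longrightarrow> free_eval k f \<in> carrier_mat (2^k) (2^k)"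
  by (subst free_eval_super[of "Poly_Mapping.keys f"]) (auto simp: free_alg_simps)

lemma free_eval_add:
  assumes "f \<in> carrier (free_alg k)" "g \<in> carrier (free_alg k)"
  shows "free_eval k (f + g) = free_eval k f + free_eval k g"
proof -
  let ?A = "Poly_Mapping.keys f \<union> Poly_Mapping.keys g"
  have A: "finite ?A" "\<And>w. w \<in> ?A \<Longrightarrow> set w \<subseteq> {1..2*k}" using assms by (auto simp: free_alg_simps)
  have "Poly_Mapping.keys (f + g) \<subseteq> ?A" by (rule Poly_Mapping.keys_add)
  then show ?thesis
    by (subst (1 2 3) free_eval_super[OF A(1) _ A(2)])
     (auto intro!: eq_matI simp: lookup_add sum.distrib algebra_simps)
qed

lemma free_eval_single:
  assumes "set w \<subseteq> {1..2*k}"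
  shows "free_eval k (Poly_Mapping.single w c) = c \<cdot>\<^sub>m word_mat k w"
proof -
  note d = carrier_matD[OF word_mat_carrier[OF assms]]
  have "free_eval k (Poly_Mapping.single w c) =
      mat (2^k) (2^k) (\<lambda>ij. \<Sum>v\<in>{w}. Poly_Mapping.lookup (Poly_Mapping.single w c) v * word_mat k v $$ ij)"
    by (rule free_eval_super) (use assms in \<open>simp_all split: if_splits\<close>)
  also have "\<dots> = c \<cdot>\<^sub>m word_mat k w"
    by (rule eq_matI) (simp_all add: d)
  finally show ?thesis .
qed

lemma free_alg_induct [consumes 1, case_names zero add]:
  assumes f: "f \<in> carrier (free_alg k)" and P0: "P 0"
   and P1: "\<And>w c f. set w \<subseteq> {1..2*k} \<Longrightarrow> f \<in> carrier (free_alg k) \<Longrightarrow> P f \<Longrightarrow> P (Poly_Mapping.single w c + f)"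
  shows "P f"
proof -
  have "P f" if "finite A" "Poly_Mapping.keys f = A" "f \<in> carrier (free_alg k)" for A f
    using that
  proof (induct A arbitrary: f)
    case empty
    then have "f = 0" by (metis empty_iff in_keys_iff lookup_zero poly_mapping_eqI)
    then show ?case using P0 by simp
  next
    case (insert w A)
    let ?g = "f - Poly_Mapping.single w (Poly_Mapping.lookup f w)"
    have "Poly_Mapping.lookup ?g v = (if v = w then 0 else Poly_Mapping.lookup f v)" for v
      by (simp add: lookup_minus lookup_single when_def)
    then have "Poly_Mapping.keys ?g = Poly_Mapping.keys f - {w}"
      by (simp add: set_eq_iff in_keys_iff)
    with insert(2,4) have k: "Poly_Mapping.keys ?g = A" by simp
    have g: "?g \<in> carrier (free_alg k)"
      using insert(4,5) unfolding free_alg_simps(1) mem_Collect_eq k by blast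
    have "P ?g" by (rule insert(3)[OF k g])
    moreover have w: "set w \<subseteq> {1..2*k}"
      using insert(4,5) unfolding free_alg_simps(1) mem_Collect_eq by blast
    ultimately have "P (Poly_Mapping.single w (Poly_Mapping.lookup f w) + ?g)"
      using P1[OF w g] by blast
    moreover have "Poly_Mapping.single w (Poly_Mapping.lookup f w) + ?g = f" by simp
    ultimately show ?case by simp
  qed
  from this[OF finite_keys refl f] show ?thesis .
qed

lemma single_in: "set w \<subseteq> {1..2*k} \<Longrightarrow> Poly_Mapping.single w c \<in> carrier (free_alg k)"
  by (auto simp: free_alg_simps split: if_splits)

lemma free_eval_0: "free_eval k 0 = 0\<^sub>m (2^k) (2^k)"
  by (subst free_eval_super[of "{}"]) auto

lemma free_eval_mult:
  assumes "f \<in> carrier (free_alg k)" "g \<in> carrier (free_alg k)"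
  shows "free_eval k (f * g) = free_eval k f * free_eval k g"
  using assms(1)
proof (induct f rule: free_alg_induct)
  case zero
  then show ?case using free_eval_carrier[OF assms(2)] by (simp add: free_eval_0)
next
  case (add v c f)
  interpret ring "free_alg k" by (rule ring_free_alg)
  note v = add(1)
  have *: "free_eval k (Poly_Mapping.single v c * g) = free_eval k (Poly_Mapping.single v c) * free_eval k g"
    using assms(2)
  proof (induct g rule: free_alg_induct)
    case zero
    show ?case using free_eval_carrier[OF single_in[OF v]] by (simp add: free_eval_0 right_mult_zero_mat[OF free_eval_carrier[OF single_in[OF v]]])
  next
    case (add w d g)
    note w = \<open>set w \<subseteq> {1..2*k}\<close>
    have a: "Poly_Mapping.single v c * Poly_Mapping.single w d = Poly_Mapping.single (v @ w) (c * d)"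
      by (simp add: mult_single plus_list_def)
    have vw: "set (v @ w) \<subseteq> {1..2*k}" using v w by auto
    have c: "Poly_Mapping.single v c * g \<in> carrier (free_alg k)"
      using m_closed[OF single_in[OF v] add(2)] by (simp add: free_alg_simps(2))
    have "free_eval k (Poly_Mapping.single v c * (Poly_Mapping.single w d + g)) =
       free_eval k (Poly_Mapping.single (v @ w) (c * d)) + free_eval k (Poly_Mapping.single v c * g)"
      by (simp add: distrib_left a free_eval_add[OF single_in[OF vw] c])
    also have "free_eval k (Poly_Mapping.single (v @ w) (c * d)) = free_eval k (Poly_Mapping.single v c) * free_eval k (Poly_Mapping.single w d)"
    proof -
      note V = word_mat_carrier[OF v] and W = word_mat_carrier[OF w]
      have "(c * d) \<cdot>\<^sub>m (word_mat k v * word_mat k w) = c \<cdot>\<^sub>m (d \<cdot>\<^sub>m (word_mat k v * word_mat k w))"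
        by (rule eq_matI) (simp_all add: mult.assoc)
      also have "\<dots> = (c \<cdot>\<^sub>m word_mat k v) * (d \<cdot>\<^sub>m word_mat k w)"
        by (simp only: mult_smult_assoc_mat[OF V smult_carrier_mat[OF W]] mult_smult_distrib[OF V W])
      finally show ?thesis
        by (simp only: free_eval_single[OF vw] free_eval_single[OF v] free_eval_single[OF w] word_mat_append[OF v w])
    qed
    finally show ?case
      by (simp add: add(3) free_eval_add[OF single_in[OF w] add(2)]
        mult_add_distrib_mat[OF free_eval_carrier[OF single_in[OF v]] free_eval_carrier[OF single_in[OF w]] free_eval_carrier[OF add(2)]])
  qed
  have c: "f * g \<in> carrier (free_alg k)" "Poly_Mapping.single v c * g \<in> carrier (free_alg k)"
      using m_closed[OF single_in[OF add(1)] assms(2)] m_closed[OF add(2) assms(2)] by (simp_all add: free_alg_simps(2))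
  show ?case
    by (simp add: distrib_right free_eval_add[OF c(2,1)] * add(3) free_eval_add[OF single_in[OF add(1)] add(2)]
      add_mult_distrib_mat[OF free_eval_carrier[OF single_in[OF add(1)]] free_eval_carrier[OF add(2)] free_eval_carrier[OF assms(2)]])
qed

lemma free_eval_1: "free_eval k 1 = 1\<^sub>m (2^k)"
proof -
  have "(1 :: nat list \<Rightarrow>\<^sub>0 complex) = Poly_Mapping.single [] 1"
    by (simp flip: single_one add: zero_list_def)
  moreover have "1 \<cdot>\<^sub>m 1\<^sub>m (2^k) = (1\<^sub>m (2^k) :: complex mat)" by auto
  ultimately show ?thesis using free_eval_single[of "[]" k 1] by (simp add: word_mat_def)
qed

lemma free_eval_hom: "ring_hom_ring (free_alg k) (mat_alg k) (free_eval k)"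
  by (rule ring_hom_ringI[OF ring_free_alg ring_mat_alg])
    (auto simp: free_alg_simps(2-) mat_alg_simps free_eval_1 free_eval_add free_eval_mult free_eval_carrier)

lemma letter_in: "j \<in> {1..2*k} \<Longrightarrow> letter j \<in> carrier (free_alg k)"
  unfolding letter_def by (rule single_in) auto

lemma free_eval_letter: "j \<in> {1..2*k} \<Longrightarrow> free_eval k (letter j) = gen_mat k j"
  unfolding letter_def by (subst free_eval_single) (auto simp: word_mat_def right_mult_one_mat[OF gen_mat_carrier])

lemma rels_in: "clifford_rels k \<subseteq> carrier (free_alg k)"
proof -
  interpret ring "free_alg k" by (rule ring_free_alg)
  have m: "letter i * letter j \<in> carrier (free_alg k)" if "i \<in> {1..2*k}" "j \<in> {1..2*k}" for i j
    using m_closed[OF letter_in letter_in, OF that] by (simp only: free_alg_simps(2))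
  have a: "f + g \<in> carrier (free_alg k)" if "f \<in> carrier (free_alg k)" "g \<in> carrier (free_alg k)" for f g
    using a_closed[OF that] by (simp only: free_alg_simps(5))
  have o: "1 \<in> carrier (free_alg k)" using one_closed by (simp only: free_alg_simps(3))
  show ?thesis
    unfolding clifford_rels_def by (intro Un_least subsetI; elim CollectE exE conjE; simp only: a m o)
qed

lemma ideal_clifford: "ideal (clifford_ideal k) (free_alg k)"
  unfolding clifford_ideal_def by (rule ring.genideal_ideal[OF ring_free_alg rels_in])

lemma free_eval_rels: "clifford_rels k \<subseteq> a_kernel (free_alg k) (mat_alg k) (free_eval k)"
proof
  interpret R: ring "free_alg k" by (rule ring_free_alg)
  fix f assume f: "f \<in> clifford_rels k"
  have fc: "f \<in> carrier (free_alg k)" using f rels_in by blast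
  have m: "letter i * letter j \<in> carrier (free_alg k)" if "i \<in> {1..2*k}" "j \<in> {1..2*k}" for i j
    using R.m_closed[OF letter_in letter_in, OF that] by (simp add: free_alg_simps(2))
  have o: "1 \<in> carrier (free_alg k)" using R.one_closed by (simp add: free_alg_simps(3))
  have z: "- A + A = 0\<^sub>m (2^k) (2^k)" if "A \<in> carrier_mat (2^k) (2^k)" for A :: "complex mat" 
    using that by auto
  from f have "free_eval k f = 0\<^sub>m (2^k) (2^k)"
    unfolding clifford_rels_def
  proof (elim UnE CollectE exE conjE)
    fix j assume f: "f = letter j * letter j + 1" and j: "j \<in> {1..2*k}"
    have "free_eval k f = gen_mat k j * gen_mat k j + 1\<^sub>m (2^k)"
      unfolding f free_eval_add[OF m[OF j j] o] free_eval_1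
        free_eval_mult[OF letter_in[OF j] letter_in[OF j]] free_eval_letter[OF j] ..
    also have "gen_mat k j * gen_mat k j = - 1\<^sub>m (2^k)"
      by (rule trans[OF gen_mat_rels[OF j j] if_P[OF refl]])
    finally show ?thesis by (simp only: z[OF one_carrier_mat])
  next
    fix j l assume f: "f = letter j * letter l + letter l * letter j" and j: "j \<in> {1..2*k}" and l: "l \<in> {1..2*k}" and ne: "j \<noteq> l"
    have "free_eval k f = gen_mat k j * gen_mat k l + gen_mat k l * gen_mat k j"
      unfolding f free_eval_add[OF m[OF j l] m[OF l j]]
        free_eval_mult[OF letter_in[OF j] letter_in[OF l]] free_eval_mult[OF letter_in[OF l] letter_in[OF j]]
        free_eval_letter[OF j] free_eval_letter[OF l] ..
    also have "gen_mat k j * gen_mat k l = - (gen_mat k l * gen_mat k j)"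
      by (rule trans[OF gen_mat_rels[OF j l] if_not_P[OF ne]])
    finally show ?thesis
      by (simp only: z[OF mult_carrier_mat[OF gen_mat_carrier[OF l] gen_mat_carrier[OF j]]])
  qed
  then show "f \<in> a_kernel (free_alg k) (mat_alg k) (free_eval k)"
    using fc by (simp add: a_kernel_def' mat_alg_simps)
qed

lemma ideal_kernel: "clifford_ideal k \<subseteq> a_kernel (free_alg k) (mat_alg k) (free_eval k)"
proof -
  interpret ring_hom_ring "free_alg k" "mat_alg k" "free_eval k" by (rule free_eval_hom)
  show ?thesis unfolding clifford_ideal_def
    by (rule R.genideal_minimal[OF kernel_is_ideal free_eval_rels])
qed

lemma rho_class:
  assumes "f \<in> carrier (free_alg k)"
  shows "rho k (clifford_class k f) = free_eval k f"
proof -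
  interpret ring_hom_ring "free_alg k" "mat_alg k" "free_eval k" by (rule free_eval_hom)
  interpret I: ideal "clifford_ideal k" "free_alg k" by (rule ideal_clifford)
  have "free_eval k x = free_eval k f" if "x \<in> clifford_class k f" for x
  proof -
    from that obtain h where h: "h \<in> clifford_ideal k" "x = h + f"
      unfolding clifford_class_def a_r_coset_def' free_alg_simps(5) by blast
    have "h \<in> a_kernel (free_alg k) (mat_alg k) (free_eval k)"
      by (rule subsetD[OF ideal_kernel h(1)])
    then have "h \<in> carrier (free_alg k)" "free_eval k h = 0\<^sub>m (2^k) (2^k)"
      unfolding a_kernel_def' mat_alg_simps(4) by simp_all
    then show ?thesis
      by (simp only: h(2) free_eval_add[OF _ assms] left_add_zero_mat[OF free_eval_carrier[OF assms]])
  qed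
  moreover have "f \<in> clifford_class k f"
    unfolding clifford_class_def by (rule I.a_rcos_self[OF assms])
  ultimately show ?thesis
    unfolding rho_def by (metis (no_types, lifting) empty_iff the_elem_image_unique)
qed

lemma ring_clifford: "ring (clifford k)"
  unfolding clifford_def by (rule ideal.quotient_is_ring[OF ideal_clifford])

lemma clifford_class_hom: "clifford_class k \<in> Ring.ring_hom (free_alg k) (clifford k)"
proof -
  have "clifford_class k = (+>\<^bsub>free_alg k\<^esub>) (clifford_ideal k)" by (rule ext) (simp add: clifford_class_def)
  then show ?thesis unfolding clifford_def using ideal.rcos_ring_hom[OF ideal_clifford, of k] by simp
qed

lemma carrier_clifford: "carrier (clifford k) = clifford_class k ` carrier (free_alg k)"
  unfolding clifford_def FactRing_def A_RCOSETS_def' clifford_class_def by auto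

lemma rho_hom: "rho k \<in> Ring.ring_hom (clifford k) (mat_alg k)"
proof -
  interpret E: ring_hom_ring "free_alg k" "mat_alg k" "free_eval k" by (rule free_eval_hom)
  interpret C: ring_hom_ring "free_alg k" "clifford k" "clifford_class k"
    by (rule ring_hom_ringI2[OF ring_free_alg ring_clifford clifford_class_hom])
  show ?thesis
  proof (rule ring_hom_memI)
    fix a assume "a \<in> carrier (clifford k)"
    then show "rho k a \<in> carrier (mat_alg k)" by (auto simp: carrier_clifford rho_class)
  next
    fix a b assume "a \<in> carrier (clifford k)" "b \<in> carrier (clifford k)"
    then obtain f g where fg: "a = clifford_class k f" "b = clifford_class k g" 
      "f \<in> carrier (free_alg k)" "g \<in> carrier (free_alg k)" by (auto simp: carrier_clifford)
    show "rho k (a \<otimes>\<^bsub>clifford k\<^esub> b) = rho k a \<otimes>\<^bsub>mat_alg k\<^esub> rho k b"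
      using fg by (simp flip: C.hom_mult add: rho_class)
    show "rho k (a \<oplus>\<^bsub>clifford k\<^esub> b) = rho k a \<oplus>\<^bsub>mat_alg k\<^esub> rho k b"
      using fg by (simp flip: C.hom_add add: rho_class)
  next
    show "rho k \<one>\<^bsub>clifford k\<^esub> = \<one>\<^bsub>mat_alg k\<^esub>"
      by (simp flip: C.hom_one add: rho_class)
  qed
qed

lemma rho_gen: "j \<in> {1..2*k} \<Longrightarrow> rho k (gen k j) = gen_mat k j"
  by (simp add: gen_def rho_class letter_in free_eval_letter)

lemma rho_scalar: "rho k (clifford_class k (Poly_Mapping.single [] c)) = c \<cdot>\<^sub>m 1\<^sub>m (2^k)"
  by (simp add: rho_class single_in free_eval_single word_mat_def)


lemmas vec_space_simps = module_vec_simps[of "TYPE(complex)" "2^k" for k, folded vec_space_def]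

lemma abelian_group_vec_space: "abelian_group (vec_space k)"
proof (rule abelian_groupI)
  fix x assume "x \<in> carrier (vec_space k)"
  then show "\<exists>y\<in>carrier (vec_space k). y \<oplus>\<^bsub>vec_space k\<^esub> x = \<zero>\<^bsub>vec_space k\<^esub>"
    by (intro bexI[of _ "- x"]) (auto simp: vec_space_simps)
qed (auto simp: vec_space_simps comm_add_vec)

lemma abelian_subgroup_lattice: "abelian_subgroup (gauss_lattice k) (vec_space k)"
proof (rule abelian_subgroupI3[OF _ abelian_group_vec_space])
  interpret abelian_group "vec_space k" by (rule abelian_group_vec_space)
  have inv: "\<ominus>\<^bsub>vec_space k\<^esub> x = - x" if "x \<in> carrier_vec (2^k)" for x
    using that by (intro minus_equality) (auto simp: vec_space_simps)
  show "additive_subgroup (gauss_lattice k) (vec_space k)"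
  proof (rule additive_subgroup.intro, rule subgroup.intro)
    fix x assume x: "x \<in> gauss_lattice k"
    have "inv\<^bsub>add_monoid (vec_space k)\<^esub> x = - x"
      using inv[of x] x by (simp add: a_inv_def gauss_lattice_def)
    then show "inv\<^bsub>add_monoid (vec_space k)\<^esub> x \<in> gauss_lattice k"
      using x unfolding gauss_lattice_def by auto
  qed (auto simp: gauss_lattice_def vec_space_simps)
qed

lemma comm_group_torus: "comm_group (torus k)"
  unfolding torus_def by (rule abelian_subgroup.a_factorgroup_is_comm_group[OF abelian_subgroup_lattice])

lemma torus_map_coset:
  assumes f: "f \<in> carrier_vec (2^k) \<rightarrow> carrier_vec (2^k)"
    and diff: "\<And>x y. x \<in> carrier_vec (2^k) \<Longrightarrow> y \<in> carrier_vec (2^k) \<Longrightarrow> f (x + y) = f x + f y"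
    and lat: "f ` gauss_lattice k \<subseteq> gauss_lattice k"
    and x: "x \<in> carrier_vec (2^k)"
  shows "torus_map k f (gauss_lattice k +>\<^bsub>vec_space k\<^esub> x) = gauss_lattice k +>\<^bsub>vec_space k\<^esub> f x"
proof -
  interpret abelian_subgroup "gauss_lattice k" "vec_space k" by (rule abelian_subgroup_lattice)
  have "gauss_lattice k +>\<^bsub>vec_space k\<^esub> f y = gauss_lattice k +>\<^bsub>vec_space k\<^esub> f x"
    if "y \<in> gauss_lattice k +>\<^bsub>vec_space k\<^esub> x" for y
  proof -
    from that obtain h where h: "h \<in> gauss_lattice k" "y = h + x"
      unfolding a_r_coset_def' by (auto simp: vec_space_simps)
    then have "f y \<in> gauss_lattice k +>\<^bsub>vec_space k\<^esub> f x"
      using diff[of h x] x lat unfolding a_r_coset_def' by (auto simp: vec_space_simps gauss_lattice_def)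
    then show ?thesis using a_repr_independence' f x
      by (metis PiE vec_space_simps(3))
  qed
  moreover have "x \<in> gauss_lattice k +>\<^bsub>vec_space k\<^esub> x" using a_rcos_self[of x] x by (simp add: vec_space_simps)
  ultimately show ?thesis unfolding torus_map_def by blast
qed

end

theory Submission
  imports Defs
begin

text \<open>Number the coordinates from 0, so that the switch of block size \<open>2^j\<close> flips bit \<open>j\<close> of the index.
  Up to signs, \<open>E\<^sub>1\<close> is \<open>\<i>\<close> times the identity, while \<open>E\<^sub>2\<close> and \<open>B\<close> are \<open>\<i>\<close> times the swap of two
  coordinates. Hence every \<open>\<rho>(e\<^sub>\<mu>)\<close> has the entries \<open>\<plusminus>\<i>^p\<close> at the positions \<open>(r, r XOR n)\<close> and is zero
  elsewhere. Signs act trivially on points of order two, so there the action depends only on \<open>n\<close>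
  and on the parity of \<open>p\<close>. All pairs occur: the generators of even index produce every \<open>n\<close>, and
  \<open>e\<^sub>1\<close> has \<open>n = 0\<close> and \<open>p = 1\<close>.\<close>

section \<open>Kernel relations and restricted maps\<close>

text \<open>Since \<open>r\<close> identifies exactly the points with equal values, \<open>f\<close>
  is constant on each class, so it may be evaluated at a chosen member. Distinct classes then give
  distinct values.\<close>

lemma kernel_quotient_bij:
  assumes r: "r = {(a, b). a \<in> A \<and> b \<in> A \<and> f a = f b}"
  shows "\<exists>\<Phi>. (\<forall>a\<in>A. \<Phi> (r `` {a}) = f a) \<and> bij_betw \<Phi> (A // r) (f ` A)"
proof -
  define \<Phi> where "\<Phi> C = f (SOME a. a \<in> C)" for C
  have \<Phi>: "\<Phi> (r `` {a}) = f a" if "a \<in> A" for a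
  proof -
    have "a \<in> r `` {a}" using that by (simp add: r)
    then have "(SOME b. b \<in> r `` {a}) \<in> r `` {a}" by (rule someI)
    moreover have "f b = f a" if "b \<in> r `` {a}" for b using that by (simp add: r)
    ultimately show ?thesis by (simp only: \<Phi>_def)
  qed
  have cls: "r `` {a} = r `` {b}" if "f a = f b" "a \<in> A" "b \<in> A" for a b
    using that by (auto simp: r)
  have "inj_on \<Phi> (A // r)"
  proof (rule inj_onI)
    fix X Y assume "X \<in> A // r" "Y \<in> A // r" "\<Phi> X = \<Phi> Y"
    then obtain a b where "X = r `` {a}" "Y = r `` {b}" "a \<in> A" "b \<in> A" "\<Phi> X = \<Phi> Y"
      by (meson quotientE)
    then show "X = Y" using cls[of a b] by (simp only: \<Phi>)
  qed
  moreover have "\<Phi> ` (A // r) = f ` A"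
    by (force simp: quotient_def \<Phi> image_iff)
  ultimately show ?thesis using \<Phi> by (auto simp: bij_betw_def)
qed

lemma restrict_eq_iff: "restrict f A = restrict g A \<longleftrightarrow> (\<forall>x\<in>A. f x = g x)"
  by (metis restrict_apply' restrict_ext)

section \<open>Bitwise xor on coordinate indices\<close>

text \<open>Truncation to \<open>k\<close> bits fixes exactly the numbers below
  \<open>2 ^ k\<close>, and it commutes with xor.\<close>

lemma xor_less_2_power:
  fixes m n :: nat
  assumes "m < 2 ^ k" "n < 2 ^ k"
  shows "xor m n < 2 ^ k"
  using assms by (simp flip: take_bit_nat_eq_self_iff)

text \<open>Because \<open>m\<close> fits into the low \<open>b\<close> bits,
  \<open>n * 2 ^ b + m\<close> is the concatenation of the bits of \<open>n\<close> and
  \<open>m\<close>, and xor works on both portions separately. This is the index splitting of a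
  Kronecker product.\<close>

lemma eq_xor_div_mod_iff:
  fixes c r n m :: nat
  assumes "m < 2 ^ b"
  shows "c = xor r (n * 2 ^ b + m) \<longleftrightarrow>
    c div 2 ^ b = xor (r div 2 ^ b) n \<and> c mod 2 ^ b = xor (r mod 2 ^ b) m"
proof -
  have "c = d \<longleftrightarrow> c div 2 ^ b = d div 2 ^ b \<and> c mod 2 ^ b = d mod 2 ^ b" for d
    by (metis div_mult_mod_eq)
  moreover have "xor r (n * 2 ^ b + m) div 2 ^ b = xor (r div 2 ^ b) n"
    using assms drop_bit_xor[of b r "n * 2 ^ b + m"] by (simp add: drop_bit_eq_div)
  moreover have "xor r (n * 2 ^ b + m) mod 2 ^ b = xor (r mod 2 ^ b) m"
    using assms take_bit_xor[of b r "n * 2 ^ b + m"] by (simp add: take_bit_eq_mod)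
  ultimately show ?thesis by metis
qed

text \<open>The parity of \<open>m div 2 ^ j\<close> is bit \<open>j\<close> of \<open>m\<close>.
  Adding \<open>2 ^ j\<close> when this bit is clear, or subtracting it when it is set, causes no
  carry and just flips the bit.\<close>

lemma switch_perm_eq_xor:
  assumes "m < 2 ^ k"
  shows "switch_perm k (2 ^ j) m = xor m (2 ^ j)"
proof -
  have add: "xor m (2 ^ j) = m + 2 ^ j" if "\<not> bit m j" for m :: nat
  proof -
    have "xor m (2 ^ j) = set_bit j m"
      by (rule bit_eqI) (use that in \<open>auto simp: bit_simps\<close>)
    then show ?thesis using that by (simp add: set_bit_eq)
  qed
  show ?thesis
  proof (cases "bit m j")
    case True
    \<comment> \<open>Flipping is an involution, so the case of a set bit follows from the case of a
      clear bit applied to the flipped number.\<close>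
    let ?n = "xor m (2 ^ j)"
    have "\<not> bit ?n j" using True by (simp add: bit_simps)
    from add[OF this] have "m = ?n + 2 ^ j" by (simp add: xor.assoc)
    then show ?thesis using assms True by (simp add: switch_perm_def bit_iff_odd)
  next
    case False
    then show ?thesis using assms add by (simp add: switch_perm_def bit_iff_odd)
  qed
qed

section \<open>Monomial matrices along a xor shift\<close>

text \<open>The signs may vary from row to row and are deliberately left open: this keeps the class
  closed under products, and signs do not matter on points of order two.\<close>

definition xor_monomial :: "nat \<Rightarrow> nat \<Rightarrow> nat \<Rightarrow> complex mat \<Rightarrow> bool" where
  "xor_monomial k p n M \<longleftrightarrow> M \<in> carrier_mat (2 ^ k) (2 ^ k) \<and> n < 2 ^ k \<and>
     (\<forall>r<2 ^ k. \<forall>c<2 ^ k. if c = xor r n then M $$ (r, c) \<in> {\<i> ^ p, - (\<i> ^ p)} else M $$ (r, c) = 0)"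

lemma xor_monomialD:
  assumes "xor_monomial k p n M"
  shows "M \<in> carrier_mat (2 ^ k) (2 ^ k)" "n < 2 ^ k" "dim_row M = 2 ^ k" "dim_col M = 2 ^ k"
    "r < 2 ^ k \<Longrightarrow> M $$ (r, xor r n) = \<i> ^ p \<or> M $$ (r, xor r n) = - (\<i> ^ p)"
    "r < 2 ^ k \<Longrightarrow> c < 2 ^ k \<Longrightarrow> c \<noteq> xor r n \<Longrightarrow> M $$ (r, c) = 0"
proof -
  show "M \<in> carrier_mat (2 ^ k) (2 ^ k)" "n < 2 ^ k" "dim_row M = 2 ^ k" "dim_col M = 2 ^ k"
    using assms by (auto simp: xor_monomial_def)
  have entry: "if c = xor r n then M $$ (r, c) \<in> {\<i> ^ p, - (\<i> ^ p)} else M $$ (r, c) = 0"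
    if "r < 2 ^ k" "c < 2 ^ k" for r c
    using assms that unfolding xor_monomial_def by blast
  show "r < 2 ^ k \<Longrightarrow> M $$ (r, xor r n) = \<i> ^ p \<or> M $$ (r, xor r n) = - (\<i> ^ p)"
    using entry[of r "xor r n"] xor_less_2_power[OF _ \<open>n < 2 ^ k\<close>] by simp
  show "r < 2 ^ k \<Longrightarrow> c < 2 ^ k \<Longrightarrow> c \<noteq> xor r n \<Longrightarrow> M $$ (r, c) = 0"
    using entry[of r c] by simp
qed

text \<open>A row has a single nonzero entry. This serves both for products of matrices and for the
  action on vectors.\<close>

lemma xor_monomial_sum:
  fixes f :: "nat \<Rightarrow> complex"
  assumes M: "xor_monomial k p n M" and r: "r < 2 ^ k"
  shows "(\<Sum>c<2 ^ k. M $$ (r, c) * f c) = M $$ (r, xor r n) * f (xor r n)"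
proof -
  have "(\<Sum>c<2 ^ k. M $$ (r, c) * f c) = (\<Sum>c\<in>{xor r n}. M $$ (r, c) * f c)"
    using xor_less_2_power[OF r xor_monomialD(2)[OF M]] xor_monomialD(6)[OF M r]
    by (intro sum.mono_neutral_right) auto
  then show ?thesis by simp
qed

text \<open>Changing \<open>p\<close> by two multiplies \<i>^p by -1, and the set of the two
  admissible entries is stable under negation.\<close>

lemma xor_monomial_parity:
  assumes "xor_monomial k p n M" "even p = even q"
  shows "xor_monomial k q n M"
proof -
  have split: "\<i> ^ p = (-1) ^ (p div 2) * \<i> ^ (p mod 2)" for p
  proof -
    have "\<i> ^ p = \<i> ^ (2 * (p div 2) + p mod 2)" by (simp only: mult_div_mod_eq)
    also have "\<dots> = (-1) ^ (p div 2) * \<i> ^ (p mod 2)"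
      unfolding power_add power_mult by simp
    finally show ?thesis .
  qed
  have "p mod 2 = q mod 2" using assms(2) by presburger
  with split[of p] split[of q]
  have "\<i> ^ p = (-1) ^ (p div 2) * \<i> ^ (q mod 2)" "\<i> ^ q = (-1) ^ (q div 2) * \<i> ^ (q mod 2)"
    by (simp_all only:)
  then have pm: "{\<i> ^ p, - (\<i> ^ p)} = {\<i> ^ q, - (\<i> ^ q)}"
    by (cases "even (p div 2)"; cases "even (q div 2)") auto
  show ?thesis using assms(1) unfolding xor_monomial_def pm .
qed

text \<open>Row \<open>r\<close> leads to \<open>xor r n\<close> and from there to
  \<open>xor (xor r n) m\<close>; the two phases multiply.\<close>

lemma xor_monomial_mult:
  assumes M: "xor_monomial k p n M" and N: "xor_monomial k q m N"
  shows "xor_monomial k (p + q) (xor n m) (M * N)"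
  unfolding xor_monomial_def
proof (intro conjI allI impI)
  note M' = xor_monomialD[OF M] and N' = xor_monomialD[OF N]
  show "M * N \<in> carrier_mat (2 ^ k) (2 ^ k)" using M' N' by (intro mult_carrier_mat)
  show "xor n m < 2 ^ k" using M' N' by (intro xor_less_2_power)
  fix r c :: nat assume r: "r < 2 ^ k" and c: "c < 2 ^ k"
  have "(M * N) $$ (r, c) = (\<Sum>l<2 ^ k. M $$ (r, l) * N $$ (l, c))"
    using r c M' N' by (simp add: scalar_prod_def atLeast0LessThan)
  also have "\<dots> = M $$ (r, xor r n) * N $$ (xor r n, c)"
    by (rule xor_monomial_sum[OF M r])
  finally have e: "(M * N) $$ (r, c) = M $$ (r, xor r n) * N $$ (xor r n, c)" .
  have rn: "xor r n < 2 ^ k" using r M' by (intro xor_less_2_power)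
  show "if c = xor r (xor n m) then (M * N) $$ (r, c) \<in> {\<i> ^ (p + q), - (\<i> ^ (p + q))} else (M * N) $$ (r, c) = 0"
    using M'(5)[OF r] N'(5)[OF rn] N'(6)[OF rn c] unfolding e
    by (auto simp: power_add xor.assoc)
qed

text \<open>The left factor acts on the high \<open>a\<close> bits of an index and the right factor
  on the low \<open>b\<close> bits, so the shifts are concatenated.\<close>

lemma xor_monomial_kron:
  assumes M: "xor_monomial a p n M" and N: "xor_monomial b q m N"
  shows "xor_monomial (a + b) (p + q) (n * 2 ^ b + m) (M \<otimes>\<^sub>K N)"
  unfolding xor_monomial_def
proof (intro conjI allI impI)
  note M' = xor_monomialD[OF M] and N' = xor_monomialD[OF N]
  show "M \<otimes>\<^sub>K N \<in> carrier_mat (2 ^ (a + b)) (2 ^ (a + b))"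
    using M' N' by (simp add: power_add)
  have "n * 2 ^ b + m < Suc n * 2 ^ b" using N' by simp
  also have "\<dots> \<le> 2 ^ a * 2 ^ b" using M' by (intro mult_le_mono1) simp
  finally show "n * 2 ^ b + m < 2 ^ (a + b)" by (simp add: power_add)
  fix r c :: nat assume r: "r < 2 ^ (a + b)" and c: "c < 2 ^ (a + b)"
  have d: "r div 2 ^ b < 2 ^ a" "r mod 2 ^ b < 2 ^ b" "c div 2 ^ b < 2 ^ a" "c mod 2 ^ b < 2 ^ b"
    using r c by (auto simp: power_add less_mult_imp_div_less)
  have e: "(M \<otimes>\<^sub>K N) $$ (r, c) =
      M $$ (r div 2 ^ b, c div 2 ^ b) * N $$ (r mod 2 ^ b, c mod 2 ^ b)"
    using r c M' N' by (simp add: kron_index power_add)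
  show "if c = xor r (n * 2 ^ b + m) then (M \<otimes>\<^sub>K N) $$ (r, c) \<in> {\<i> ^ (p + q), - (\<i> ^ (p + q))}
        else (M \<otimes>\<^sub>K N) $$ (r, c) = 0"
    using M'(5)[OF d(1)] N'(5)[OF d(2)] M'(6)[OF d(1,3)] N'(6)[OF d(2,4)]
    unfolding e eq_xor_div_mod_iff[OF N'(2)] by (auto simp: power_add)
qed

lemma xor_monomial_one: "xor_monomial k 0 0 (1\<^sub>m (2 ^ k))"
  by (auto simp: xor_monomial_def)

lemma xor_monomial_uminus: "xor_monomial k p n M \<Longrightarrow> xor_monomial k p n (- M)"
  by (fastforce simp: xor_monomial_def)

section \<open>Phase and shift of the generators\<close>

lemma xor_monomial_pauli:
  "xor_monomial 1 1 0 E1" "xor_monomial 1 1 1 E2" "xor_monomial 1 1 1 Bmat"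
  by (auto simp: xor_monomial_def less_2_cases_iff)

text \<open>Each factor flips its own bit and contributes one factor \<i> up to sign, so all
  \<open>n\<close> low bits are flipped.\<close>

lemma xor_monomial_kron_pow_Bmat: "xor_monomial n n (mask n) (kron_pow Bmat n)"
proof (induct n)
  case 0
  show ?case using xor_monomial_one[of 0] by simp
next
  case (Suc n)
  have "1 * 2 ^ n + mask n = (mask (Suc n) :: nat)" by (simp add: mask_Suc_exp mask_eq_exp_minus_1)
  then show ?case using xor_monomial_kron[OF xor_monomial_pauli(3) Suc] by simp
qed

text \<open>With \<open>j = (i + 1) div 2\<close> there are \<open>j\<close> factors different from
  the identity, each with phase \<i>. The \<open>j - 1\<close> copies of \<open>Bmat\<close> flip
  the lowest bits; the next bit is flipped by \<open>E2\<close> but not by \<open>E1\<close>. In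
  both cases \<open>i div 2\<close> bits are flipped.\<close>

lemma xor_monomial_gen_mat:
  assumes i: "i \<in> {1..2 * k}"
  shows "xor_monomial k ((i + 1) div 2) (mask (i div 2)) (gen_mat k i)"
proof -
  define j where "j = (i + 1) div 2"
  have j: "1 \<le> j" "j \<le> k" using i by (auto simp: j_def)
  have one: "xor_monomial (k - j) 0 0 (kron_pow (1\<^sub>m 2) (k - j))"
    by (simp add: kron_pow_one xor_monomial_one)
  note B = xor_monomial_kron_pow_Bmat[of "j - 1"]
  show ?thesis
  proof (cases "odd i")
    case True
    then have "i div 2 = j - 1" by (auto simp: j_def elim!: oddE)
    then show ?thesis using True j
        xor_monomial_kron[OF one xor_monomial_kron[OF xor_monomial_pauli(1) B]]
      by (simp add: gen_mat_def Let_def flip: j_def)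
  next
    case False
    then have "i div 2 = Suc (j - 1)" using j by (auto simp: j_def)
    moreover have "1 * 2 ^ (j - 1) + mask (j - 1) = (mask (Suc (j - 1)) :: nat)"
      by (simp add: mask_eq_exp_minus_1)
    ultimately show ?thesis using False j
        xor_monomial_kron[OF one xor_monomial_kron[OF xor_monomial_pauli(2) B]]
      by (simp add: gen_mat_def Let_def flip: j_def)
  qed
qed

section \<open>Phases and shifts realised by increasing words\<close>

lemma word_mat_Cons: "word_mat k (i # w) = gen_mat k i * word_mat k w"
  by (simp add: word_mat_def)

lemma xor_monomial_word_mat:
  "set w \<subseteq> {1..2 * k} \<Longrightarrow> \<exists>p n. xor_monomial k p n (word_mat k w)"
proof (induct w)
  case Nil
  then show ?case using xor_monomial_one by (auto simp: word_mat_def)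
next
  case (Cons i w)
  then obtain p n where "xor_monomial k p n (word_mat k w)" by auto
  from xor_monomial_mult[OF xor_monomial_gen_mat this] Cons.prems show ?case
    unfolding word_mat_Cons by auto
qed

text \<open>The masks \<open>2^j - 1\<close> of the generators \<open>e\<^sub>2\<^sub>j\<close> form a triangular basis of the bit vectors.\<close>

lemma exists_even_word:
  assumes "l \<le> k" "n < 2 ^ l"
  shows "\<exists>w p. sorted_wrt (<) w \<and> set w \<subseteq> {2..2 * l} \<and> xor_monomial k p n (word_mat k w)"
  using assms
proof (induct l arbitrary: n)
  case 0
  then show ?case using xor_monomial_one by (intro exI[of _ "[]"]) (auto simp: word_mat_def)
next
  case (Suc l)
  show ?case
  proof (cases "n < 2 ^ l")
    case True
    then show ?thesis using Suc.hyps[of n] Suc.prems by fastforce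
  next
    case False
    \<comment> \<open>Here bit \<open>l\<close> is the leading bit of \<open>n\<close> and also of
      \<open>mask (Suc l)\<close>, so xor clears it and the induction hypothesis applies.\<close>
    define n' where "n' = xor n (mask (Suc l))"
    have "n' < 2 ^ l"
    proof -
      have "n div 2 ^ l < 2" using Suc.prems by (simp add: less_mult_imp_div_less)
      moreover have "n div 2 ^ l \<noteq> 0" using False by (simp add: div_eq_0_iff)
      ultimately have "n div 2 ^ l = 1" by linarith
      moreover have "mask (Suc l) = 1 * 2 ^ l + (2 ^ l - 1 :: nat)" by (simp add: mask_eq_exp_minus_1)
      ultimately have "n' div 2 ^ l = 0"
        using eq_xor_div_mod_iff[of "2 ^ l - 1" l n' n 1] by (simp add: n'_def)
      then show ?thesis by (simp add: div_eq_0_iff)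
    qed
    then obtain w p where w: "sorted_wrt (<) w" "set w \<subseteq> {2..2 * l}" "xor_monomial k p n' (word_mat k w)"
      using Suc.hyps[of n'] Suc.prems by auto
    \<comment> \<open>This generator has the shift \<open>mask (Suc l)\<close>, which turns
      \<open>n'\<close> back into \<open>n\<close>; its index exceeds all letters of
      \<open>w\<close>, so appending it keeps the word increasing.\<close>
    let ?i = "2 * Suc l"
    have i: "?i \<in> {1..2 * k}" using Suc.prems by auto
    have "set w \<subseteq> {1..2 * k}" using w(2) Suc.prems by force
    then have "word_mat k (w @ [?i]) = word_mat k w * gen_mat k ?i"
      using i by (simp add: word_mat_append word_mat_Cons del: mult_Suc_right)
        (simp add: word_mat_def right_mult_one_mat[OF gen_mat_carrier])
    moreover have "xor n' (mask (?i div 2)) = n" by (simp add: n'_def xor.assoc)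
    ultimately have "xor_monomial k (p + (?i + 1) div 2) n (word_mat k (w @ [?i]))"
      using xor_monomial_mult[OF w(3) xor_monomial_gen_mat[OF i]] by simp
    moreover have "sorted_wrt (<) (w @ [?i])" "set (w @ [?i]) \<subseteq> {2..?i}"
      using w by (force simp: sorted_wrt_append)+
    ultimately show ?thesis by blast
  qed
qed

text \<open>The word in generators of even index yields the shift with some phase. If the parity is
  wrong, prefixing generator 1 corrects it without changing the shift; the other letters are at
  least 2, so the word remains increasing.\<close>

lemma exists_word:
  assumes "1 \<le> k" "n < 2 ^ k"
  shows "\<exists>w. sorted_wrt (<) w \<and> set w \<subseteq> {1..2 * k} \<and> xor_monomial k p n (word_mat k w)"
proof -
  obtain w q where w: "sorted_wrt (<) w" "set w \<subseteq> {2..2 * k}" "xor_monomial k q n (word_mat k w)"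
    using exists_even_word[OF order_refl assms(2)] by blast
  show ?thesis
  proof (cases "even p = even q")
    case True
    then have "xor_monomial k p n (word_mat k w)" using xor_monomial_parity[OF w(3)] by simp
    then show ?thesis using w by fastforce
  next
    case False
    have "xor_monomial k (1 + q) n (word_mat k (1 # w))"
      using xor_monomial_mult[OF xor_monomial_gen_mat[of 1 k] w(3)] assms(1) by (simp add: word_mat_Cons)
    then have "xor_monomial k p n (word_mat k (1 # w))"
      using xor_monomial_parity False by fastforce
    moreover have "sorted_wrt (<) (1 # w)" "set (1 # w) \<subseteq> {1..2 * k}"
      using w assms(1) by force+
    ultimately show ?thesis by blast
  qed
qed

section \<open>Passage from words to the group in the Clifford algebra\<close>

lemma rho_ring_hom: "ring_hom_ring (clifford k) (mat_alg k) (rho k)"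
  by (rule ring_hom_ringI2[OF ring_clifford ring_mat_alg rho_hom])

lemma gen_carrier: "i \<in> {1..2 * k} \<Longrightarrow> gen k i \<in> carrier (clifford k)"
  unfolding gen_def carrier_clifford by (intro imageI letter_in)

text \<open>Membership is carried through the induction because multiplicativity of
  \<open>rho k\<close> is available on the carrier.\<close>

lemma rho_gen_prod:
  assumes "set w \<subseteq> {1..2 * k}"
  shows "gen_prod k w \<in> carrier (clifford k) \<and> rho k (gen_prod k w) = word_mat k w"
proof -
  interpret R: ring "clifford k" by (rule ring_clifford)
  show ?thesis using assms
  proof (induct w)
    case Nil
    have "rho k \<one>\<^bsub>clifford k\<^esub> = 1\<^sub>m (2 ^ k)"
      using ring_hom_one[OF rho_hom] by (simp only: mat_alg_simps(3))
    then show ?case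
      using R.one_closed by (simp only: gen_prod_def word_mat_def foldr.simps id_apply)
  next
    case (Cons i w)
    then have i: "gen k i \<in> carrier (clifford k)" "rho k (gen k i) = gen_mat k i"
      and w: "gen_prod k w \<in> carrier (clifford k)" "rho k (gen_prod k w) = word_mat k w"
      by (auto intro: gen_carrier simp: rho_gen)
    have "gen_prod k (i # w) = gen k i \<otimes>\<^bsub>clifford k\<^esub> gen_prod k w" by (simp add: gen_prod_def)
    moreover have "rho k (gen k i \<otimes>\<^bsub>clifford k\<^esub> gen_prod k w) = gen_mat k i * word_mat k w"
      using ring_hom_mult[OF rho_hom i(1) w(1)] by (simp only: mat_alg_simps(1) i(2) w(2))
    ultimately show ?case using R.m_closed[OF i(1) w(1)] by (simp only: word_mat_Cons)
  qed
qed

lemma mat_alg_a_inv: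
  assumes "A \<in> carrier_mat (2 ^ k) (2 ^ k)"
  shows "\<ominus>\<^bsub>mat_alg k\<^esub> A = - A"
proof -
  interpret ring "mat_alg k" by (rule ring_mat_alg)
  show ?thesis using assms by (intro minus_equality) (auto simp: mat_alg_simps)
qed

text \<open>Group elements are products of generators up to sign, and a global sign is absorbed by
  the open signs of \<open>xor_monomial\<close>.\<close>

lemma Gamma_hat_xor_monomial:
  assumes "a \<in> carrier (Gamma_hat k)"
  shows "\<exists>p n. xor_monomial k p n (rho k a)"
proof -
  interpret ring_hom_ring "clifford k" "mat_alg k" "rho k" by (rule rho_ring_hom)
  obtain w where w: "set w \<subseteq> {1..2 * k}" "a = gen_prod k w \<or> a = \<ominus>\<^bsub>clifford k\<^esub> gen_prod k w"
    using assms by (auto simp: Gamma_hat_def)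
  then have "rho k a = word_mat k w \<or> rho k a = - word_mat k w"
    using rho_gen_prod[OF w(1)] by (auto simp: mat_alg_a_inv word_mat_carrier)
  then show ?thesis using xor_monomial_word_mat[OF w(1)] xor_monomial_uminus by metis
qed

section \<open>The torus and its points of order two\<close>

abbreviation lattice_coset :: "nat \<Rightarrow> complex vec \<Rightarrow> complex vec set" where
  "lattice_coset k x \<equiv> gauss_lattice k +>\<^bsub>vec_space k\<^esub> x"

lemma carrier_torus: "carrier (torus k) = lattice_coset k ` carrier_vec (2 ^ k)"
proof -
  have "carrier (torus k) = a_rcosets\<^bsub>vec_space k\<^esub> gauss_lattice k"
    by (simp add: torus_def A_FactGroup_def FactGroup_def A_RCOSETS_def)
  also have "\<dots> = lattice_coset k ` carrier_vec (2 ^ k)"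
    unfolding A_RCOSETS_def' vec_space_simps by auto
  finally show ?thesis .
qed

lemma lattice_coset_eqI:
  assumes "x \<in> carrier_vec (2 ^ k)" "y \<in> carrier_vec (2 ^ k)" "x - y \<in> gauss_lattice k"
  shows "lattice_coset k x = lattice_coset k y"
proof -
  interpret abelian_subgroup "gauss_lattice k" "vec_space k" by (rule abelian_subgroup_lattice)
  have "x = (x - y) + y" using assms(1,2) by auto
  then have "x \<in> lattice_coset k y"
    using assms(3) by (auto simp: a_r_coset_def' vec_space_simps)
  then show ?thesis using a_repr_independence' assms(2) by (metis vec_space_simps(3))
qed

text \<open>Doubling \<open>v\<close> gives the coset of \<open>x + x\<close>; if this is the
  lattice itself, then it contains \<open>x + x\<close>. Negating an entry of \<open>x\<close>
  therefore changes it by a Gaussian integer.\<close>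

lemma J2_cases:
  assumes "v \<in> J2 k"
  obtains x where "x \<in> carrier_vec (2 ^ k)" "v = lattice_coset k x"
    "\<forall>m<2 ^ k. Re (2 * x $ m) \<in> \<int> \<and> Im (2 * x $ m) \<in> \<int>"
proof -
  interpret abelian_subgroup "gauss_lattice k" "vec_space k" by (rule abelian_subgroup_lattice)
  have v: "v \<in> carrier (torus k)" "v \<otimes>\<^bsub>torus k\<^esub> v = \<one>\<^bsub>torus k\<^esub>"
    using assms by (auto simp: J2_def)
  obtain x where x: "x \<in> carrier_vec (2 ^ k)" "v = lattice_coset k x"
    using v(1) unfolding carrier_torus by blast
  have "v \<otimes>\<^bsub>torus k\<^esub> v = lattice_coset k (x + x)"
    using a_rcos_sum[of x x] x by (simp add: torus_def A_FactGroup_def FactGroup_def set_add_def vec_space_simps)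
  then have "lattice_coset k (x + x) = gauss_lattice k"
    using v(2) by (simp add: torus_def A_FactGroup_def FactGroup_def)
  moreover have "x + x \<in> lattice_coset k (x + x)"
    using a_rcos_self[of "x + x"] x by (simp add: vec_space_simps)
  ultimately have "x + x \<in> gauss_lattice k" by simp
  then have "\<forall>m<2 ^ k. Re (2 * x $ m) \<in> \<int> \<and> Im (2 * x $ m) \<in> \<int>"
    using x by (auto simp: gauss_lattice_def simp flip: mult_2)
  with x show ?thesis by (rule that)
qed

section \<open>Phase shifts as a common normal form\<close>

text \<open>Both kinds of action are compared through this map: one global phase and one bit shift,
  without the row signs of the matrices.\<close>

definition shift_vec :: "nat \<Rightarrow> nat \<Rightarrow> nat \<Rightarrow> complex vec \<Rightarrow> complex vec" where
  "shift_vec k p n x = vec (2 ^ k) (\<lambda>m. \<i> ^ p * x $ xor m n)"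

definition shift_act :: "nat \<Rightarrow> nat \<Rightarrow> nat \<Rightarrow> complex vec set \<Rightarrow> complex vec set" where
  "shift_act k p n = torus_map k (shift_vec k p n)"

text \<open>Multiplication by \<i> exchanges real and imaginary part up to sign.\<close>

lemma i_power_mult_Ints:
  assumes "Re z \<in> \<int>" "Im z \<in> \<int>"
  shows "Re (\<i> ^ p * z) \<in> \<int> \<and> Im (\<i> ^ p * z) \<in> \<int>"
proof (induct p)
  case 0
  show ?case using assms by simp
next
  case (Suc p)
  have "Re (\<i> * w) = - Im w" "Im (\<i> * w) = Re w" for w by simp_all
  then show ?case using Suc by (simp only: power_Suc mult.assoc Ints_minus)
qed

lemma shift_vec_carrier: "shift_vec k p n x \<in> carrier_vec (2 ^ k)"
  by (simp add: shift_vec_def)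

lemma shift_act_coset:
  assumes "n < 2 ^ k" "x \<in> carrier_vec (2 ^ k)"
  shows "shift_act k p n (lattice_coset k x) = lattice_coset k (shift_vec k p n x)"
  unfolding shift_act_def
proof (rule torus_map_coset[OF _ _ _ assms(2)])
  show "shift_vec k p n \<in> carrier_vec (2 ^ k) \<rightarrow> carrier_vec (2 ^ k)" by (simp add: shift_vec_def)
  show "shift_vec k p n (x + y) = shift_vec k p n x + shift_vec k p n y"
    if "x \<in> carrier_vec (2 ^ k)" "y \<in> carrier_vec (2 ^ k)" for x y
    using that xor_less_2_power[OF _ assms(1)] by (auto simp: shift_vec_def distrib_left)
  show "shift_vec k p n ` gauss_lattice k \<subseteq> gauss_lattice k"
    using xor_less_2_power[OF _ assms(1)] i_power_mult_Ints
    by (auto simp: gauss_lattice_def shift_vec_def)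
qed

lemma shift_vec_shift_vec:
  assumes "n < 2 ^ k"
  shows "shift_vec k p n (shift_vec k q m x) = shift_vec k (p + q) (xor m n) x"
  using xor_less_2_power[OF _ assms]
  by (auto simp: shift_vec_def power_add xor.assoc xor.commute[of n m])

lemma shift_act_comp:
  assumes "n < 2 ^ k" "m < 2 ^ k" "v \<in> carrier (torus k)"
  shows "shift_act k p n (shift_act k q m v) = shift_act k (p + q) (xor m n) v"
  using assms unfolding carrier_torus
  by (auto simp: shift_act_coset shift_vec_carrier shift_vec_shift_vec xor_less_2_power)

lemma shift_act_0:
  assumes "v \<in> carrier (torus k)"
  shows "shift_act k 0 0 v = v"
proof -
  have "shift_vec k 0 0 x = x" if "x \<in> carrier_vec (2 ^ k)" for x
    using that by (auto simp: shift_vec_def)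
  then show ?thesis using assms by (auto simp: carrier_torus shift_act_coset)
qed

text \<open>On \<open>J2 k\<close> signs disappear, so only the phase and the bit shift of a monomial matrix survive.\<close>

lemma clifford_act_eq_shift_act:
  assumes M: "xor_monomial k p n (rho k a)" and v: "v \<in> J2 k"
  shows "clifford_act k a v = shift_act k p n v"
proof -
  note M' = xor_monomialD[OF M]
  have index: "(rho k a *\<^sub>v x) $ r = rho k a $$ (r, xor r n) * x $ xor r n"
    if "x \<in> carrier_vec (2 ^ k)" "r < 2 ^ k" for x r
    using that M' xor_monomial_sum[OF M that(2), of "\<lambda>c. x $ c"]
    by (simp add: scalar_prod_def atLeast0LessThan)
  obtain x where x: "x \<in> carrier_vec (2 ^ k)" "v = lattice_coset k x"
    "\<forall>m<2 ^ k. Re (2 * x $ m) \<in> \<int> \<and> Im (2 * x $ m) \<in> \<int>"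
    by (rule J2_cases[OF v])
  have carr: "rho k a *\<^sub>v y \<in> carrier_vec (2 ^ k)" if "y \<in> carrier_vec (2 ^ k)" for y
    using M'(1) that by (rule mult_mat_vec_carrier)
  have "clifford_act k a v = lattice_coset k (rho k a *\<^sub>v x)"
    unfolding clifford_act_def x(2)
  proof (rule torus_map_coset[OF _ _ _ x(1)])
    show "(*\<^sub>v) (rho k a) \<in> carrier_vec (2 ^ k) \<rightarrow> carrier_vec (2 ^ k)" using carr by blast
    show "rho k a *\<^sub>v (y + z) = rho k a *\<^sub>v y + rho k a *\<^sub>v z"
      if "y \<in> carrier_vec (2 ^ k)" "z \<in> carrier_vec (2 ^ k)" for y z
      using M'(1) that by (rule mult_add_distrib_mat_vec)
    show "(*\<^sub>v) (rho k a) ` gauss_lattice k \<subseteq> gauss_lattice k"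
    proof (rule image_subsetI)
      fix y assume y: "y \<in> gauss_lattice k"
      then have yc: "y \<in> carrier_vec (2 ^ k)" by (simp add: gauss_lattice_def)
      \<comment> \<open>Row \<open>r\<close> picks one entry of \<open>y\<close> and multiplies it
        by a unit of the Gaussian integers.\<close>
      have "Re ((rho k a *\<^sub>v y) $ r) \<in> \<int> \<and> Im ((rho k a *\<^sub>v y) $ r) \<in> \<int>" if r: "r < 2 ^ k" for r
      proof -
        let ?z = "y $ xor r n"
        have "(rho k a *\<^sub>v y) $ r = \<i> ^ p * ?z \<or> (rho k a *\<^sub>v y) $ r = - (\<i> ^ p * ?z)"
          using M'(5)[OF r] index[OF yc r] by auto
        moreover have "Re (\<i> ^ p * ?z) \<in> \<int> \<and> Im (\<i> ^ p * ?z) \<in> \<int>"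
          using y xor_less_2_power[OF r M'(2)] by (intro i_power_mult_Ints) (auto simp: gauss_lattice_def)
        ultimately show ?thesis
          by (elim disjE) (simp_all only: uminus_complex.simps minus_in_Ints_iff)
      qed
      then show "rho k a *\<^sub>v y \<in> gauss_lattice k" using carr[OF yc] by (simp add: gauss_lattice_def)
    qed
  qed
  also have "\<dots> = lattice_coset k (shift_vec k p n x)"
  proof (rule lattice_coset_eqI[OF carr[OF x(1)] shift_vec_carrier])
    let ?d = "rho k a *\<^sub>v x - shift_vec k p n x"
    have "Re (?d $ r) \<in> \<int> \<and> Im (?d $ r) \<in> \<int>" if r: "r < 2 ^ k" for r
    proof -
      \<comment> \<open>The two phases agree or are opposite. In the second case the difference is a
        unit times twice an entry of \<open>x\<close>, hence a Gaussian integer.\<close>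
      have "?d $ r = (rho k a $$ (r, xor r n) - \<i> ^ p) * x $ xor r n"
        using r index[OF x(1) r] by (simp add: shift_vec_def algebra_simps)
      then have "?d $ r = 0 \<or> ?d $ r = - (\<i> ^ p * (2 * x $ xor r n))"
        using M'(5)[OF r] by fastforce
      moreover have "Re (\<i> ^ p * (2 * x $ xor r n)) \<in> \<int> \<and> Im (\<i> ^ p * (2 * x $ xor r n)) \<in> \<int>"
        using x(3) xor_less_2_power[OF r M'(2)] by (intro i_power_mult_Ints) auto
      ultimately show ?thesis
        by (elim disjE) (simp_all only: uminus_complex.simps minus_in_Ints_iff zero_complex.simps Ints_0 simp_thms)
    qed
    moreover have "?d \<in> carrier_vec (2 ^ k)"
      by (rule minus_carrier_vec[OF carr[OF x(1)] shift_vec_carrier])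
    ultimately show "?d \<in> gauss_lattice k" by (simp only: gauss_lattice_def mem_Collect_eq) blast
  qed
  also have "\<dots> = shift_act k p n v" using M'(2) x by (simp add: shift_act_coset)
  finally show ?thesis .
qed

section \<open>Switches and multiplication by \<i> as phase shifts\<close>

text \<open>The union in \<open>torus_map\<close> runs over the members of a coset, all of length
  \<open>2 ^ k\<close>. Scalar multiplication and \<open>shift_vec\<close> need only be compared on
  such vectors.\<close>

lemma torus_map_cong_coset:
  assumes "\<And>x. x \<in> carrier_vec (2 ^ k) \<Longrightarrow> f x = g x" "v \<in> carrier (torus k)"
  shows "torus_map k f v = torus_map k g v"
proof -
  have "v \<subseteq> carrier_vec (2 ^ k)"
    using assms(2) by (auto simp: carrier_torus a_r_coset_def' gauss_lattice_def vec_space_simps)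
  then show ?thesis unfolding torus_map_def using assms(1) by (intro SUP_cong refl) auto
qed

lemma perm_act_eq_shift_act:
  assumes "\<And>m. m < 2 ^ k \<Longrightarrow> \<sigma> m = xor m n" "v \<in> carrier (torus k)"
  shows "perm_act k \<sigma> v = shift_act k 0 n v"
  unfolding perm_act_def shift_act_def using assms(2)
  by (intro torus_map_cong_coset) (auto simp: shift_vec_def assms(1))

lemma i_act_eq_shift_act:
  assumes "v \<in> carrier (torus k)"
  shows "i_act k v = shift_act k 1 0 v"
  unfolding i_act_def shift_act_def using assms
  by (intro torus_map_cong_coset) (auto simp: shift_vec_def)

lemma shift_act_carrier:
  assumes "n < 2 ^ k" "v \<in> carrier (torus k)"
  shows "shift_act k p n v \<in> carrier (torus k)"
  using assms unfolding carrier_torus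
  by (auto simp: shift_act_coset shift_vec_carrier)

text \<open>Factor \<open>Suc j\<close> flips bit \<open>j\<close> if it is a switch, so the first
  \<open>l\<close> factors together flip exactly the bits of \<open>n\<close> below
  \<open>l\<close>.\<close>

lemma perm_chain_eq_shift_act:
  assumes "l \<le> k" "\<And>j. j < l \<Longrightarrow> \<sigma> (Suc j) = (if bit n j then switch_perm k (2 ^ j) else id)"
    "v \<in> carrier (torus k)"
  shows "perm_chain k \<sigma> l v = shift_act k 0 (take_bit l n) v"
  using assms(1,2)
proof (induct l)
  case 0
  then show ?case using assms(3) by (simp add: shift_act_0)
next
  case (Suc l)
  \<comment> \<open>Shift of the next factor, which is 0 for the identity; both choices are then
    handled as one xor.\<close>
  let ?b = "of_bool (bit n l) * 2 ^ l :: nat"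
  have "?b < 2 ^ k" using Suc.prems(1) by simp
  have t: "take_bit l n < 2 ^ k" using Suc.prems(1)
    by (meson Suc_leD less_le_trans one_le_numeral power_increasing take_bit_nat_less_exp)
  have IH: "perm_chain k \<sigma> l v = shift_act k 0 (take_bit l n) v" using Suc by simp
  have "\<sigma> (Suc l) m = xor m ?b" if "m < 2 ^ k" for m
    using Suc.prems(2)[of l] that by (simp add: switch_perm_eq_xor)
  then have "perm_chain k \<sigma> (Suc l) v = shift_act k 0 ?b (shift_act k 0 (take_bit l n) v)"
    using perm_act_eq_shift_act shift_act_carrier[OF t assms(3)] by (simp add: IH)
  also have "\<dots> = shift_act k 0 (xor (take_bit l n) ?b) v"
    using shift_act_comp[OF \<open>?b < 2 ^ k\<close> t assms(3)] by simp
  also have "xor (take_bit l n) ?b = take_bit (Suc l) n"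
    by (rule bit_eqI) (auto simp: bit_simps less_Suc_eq)
  finally show ?case .
qed

text \<open>The binary number with the truth values of \<open>P\<close> as its digits does this; a
  Horner sum evaluates it.\<close>

lemma exists_bits: "\<exists>n::nat. n < 2 ^ l \<and> (\<forall>j<l. bit n j = P j)"
proof (intro exI conjI allI impI)
  let ?n = "horner_sum of_bool 2 (map P [0..<l]) :: nat"
  show "?n < 2 ^ l" using horner_sum_of_bool_2_less[of "map P [0..<l]"] by (simp flip: of_nat_less_iff)
  show "bit ?n j = P j" if "j < l" for j using that by (simp add: bit_horner_sum_bit_iff)
qed

lemma switch_maps_imp_shift_act:
  assumes "S \<in> switch_maps k"
  obtains n where "n < 2 ^ k" "\<forall>v\<in>carrier (torus k). S v = shift_act k 0 n v"
proof -
  obtain \<sigma> where S: "S = perm_chain k \<sigma> k"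
    and \<sigma>: "\<forall>l\<in>{1..k}. \<sigma> l \<in> {id, switch_perm k (2 ^ (l - 1))}"
    using assms by (auto simp: switch_maps_def)
  \<comment> \<open>Bit \<open>j\<close> of \<open>n\<close> records whether factor
    \<open>Suc j\<close> is a genuine switch.\<close>
  obtain n :: nat where n: "n < 2 ^ k" "\<forall>j<k. bit n j = (\<sigma> (Suc j) \<noteq> id)"
    using exists_bits[of k "\<lambda>j. \<sigma> (Suc j) \<noteq> id"] by blast
  have "\<sigma> (Suc j) = (if bit n j then switch_perm k (2 ^ j) else id)" if "j < k" for j
    using bspec[OF \<sigma>, of "Suc j"] n(2) that by auto
  then have "\<forall>v\<in>carrier (torus k). S v = shift_act k 0 n v"
    using perm_chain_eq_shift_act[OF order_refl, of k \<sigma> n] n(1) by (simp add: S take_bit_nat_eq_self)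
  with n(1) show ?thesis by (rule that)
qed

lemma shift_act_imp_switch_maps:
  assumes "n < 2 ^ k"
  obtains S where "S \<in> switch_maps k" "\<forall>v\<in>carrier (torus k). S v = shift_act k 0 n v"
proof
  let ?\<sigma> = "\<lambda>l. if bit n (l - 1) then switch_perm k (2 ^ (l - 1)) else id"
  show "perm_chain k ?\<sigma> k \<in> switch_maps k"
    unfolding switch_maps_def by (intro CollectI exI[of _ ?\<sigma>]) simp
  show "\<forall>v\<in>carrier (torus k). perm_chain k ?\<sigma> k v = shift_act k 0 n v"
    using perm_chain_eq_shift_act[OF order_refl, of k ?\<sigma> n] assms by (simp add: take_bit_nat_eq_self)
qed

lemma i_act_shift_act:
  assumes "n < 2 ^ k" "v \<in> carrier (torus k)"
  shows "i_act k (shift_act k 0 n v) = shift_act k 1 n v"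
  using assms by (simp add: i_act_eq_shift_act shift_act_carrier shift_act_comp)

lemma J2_subset_torus: "J2 k \<subseteq> carrier (torus k)"
  by (auto simp: J2_def)

section \<open>Equality of the two sets of actions\<close>

text \<open>The bits of \<open>n\<close> encode the choice of switches, and \<open>p\<close> tells
  whether multiplication by \<i> follows.\<close>

lemma switch_actions_eq:
  "switch_actions k = {restrict (shift_act k p n) (J2 k) | p n. p < 2 \<and> n < 2 ^ k}" (is "_ = ?R")
proof
  show "switch_actions k \<subseteq> ?R"
  proof
    fix f assume "f \<in> switch_actions k"
    then obtain S where S: "S \<in> switch_maps k"
      and f: "f = restrict S (J2 k) \<or> f = restrict (i_act k \<circ> S) (J2 k)"
      by (auto simp: switch_actions_def)
    obtain n where n: "n < 2 ^ k" "\<forall>v\<in>carrier (torus k). S v = shift_act k 0 n v"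
      by (rule switch_maps_imp_shift_act[OF S])
    have "restrict S (J2 k) = restrict (shift_act k 0 n) (J2 k)"
      "restrict (i_act k \<circ> S) (J2 k) = restrict (shift_act k 1 n) (J2 k)"
      using n J2_subset_torus[of k] by (auto simp: i_act_shift_act intro!: restrict_ext)
    then show "f \<in> ?R" using f n(1) by force
  qed
  show "?R \<subseteq> switch_actions k"
  proof
    fix f assume "f \<in> ?R"
    then obtain p n where f: "f = restrict (shift_act k p n) (J2 k)" and p: "p = 0 \<or> p = 1" and n: "n < 2 ^ k"
      by (auto simp: less_2_cases_iff)
    obtain S where S: "S \<in> switch_maps k" "\<forall>v\<in>carrier (torus k). S v = shift_act k 0 n v"
      by (rule shift_act_imp_switch_maps[OF n])
    have "restrict (shift_act k 0 n) (J2 k) = restrict S (J2 k)"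
      "restrict (shift_act k 1 n) (J2 k) = restrict (i_act k \<circ> S) (J2 k)"
      using n S J2_subset_torus[of k] by (auto simp: i_act_shift_act intro!: restrict_ext)
    then show "f \<in> switch_actions k" using f p S(1) by (auto simp: switch_actions_def)
  qed
qed

text \<open>One inclusion reads phase and shift off the monomial matrix of a group element; the
  other realises any prescribed pair by an increasing word.\<close>

lemma clifford_actions_eq:
  assumes "1 \<le> k"
  shows "(\<lambda>a. restrict (clifford_act k a) (J2 k)) ` carrier (Gamma_hat k) = switch_actions k"
  unfolding switch_actions_eq
proof (intro equalityI subsetI)
  fix f assume "f \<in> (\<lambda>a. restrict (clifford_act k a) (J2 k)) ` carrier (Gamma_hat k)"
  then obtain a where a: "a \<in> carrier (Gamma_hat k)" "f = restrict (clifford_act k a) (J2 k)" by blast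
  obtain p n where "xor_monomial k p n (rho k a)" using Gamma_hat_xor_monomial[OF a(1)] by blast
  \<comment> \<open>Reducing the phase modulo 2 costs only signs and brings it into the range
    \<open>p < 2\<close>.\<close>
  then have M: "xor_monomial k (p mod 2) n (rho k a)" by (rule xor_monomial_parity) simp
  then have "f = restrict (shift_act k (p mod 2) n) (J2 k)"
    by (simp add: a(2) clifford_act_eq_shift_act cong: restrict_cong)
  then show "f \<in> {restrict (shift_act k p n) (J2 k) | p n. p < 2 \<and> n < 2 ^ k}"
    using xor_monomialD(2)[OF M] mod_less_divisor[OF zero_less_numeral] by blast
next
  fix f assume "f \<in> {restrict (shift_act k p n) (J2 k) | p n. p < 2 \<and> n < 2 ^ k}"
  then obtain p n where f: "f = restrict (shift_act k p n) (J2 k)" and n: "n < 2 ^ k" by blast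
  obtain w where w: "sorted_wrt (<) w" "set w \<subseteq> {1..2 * k}" "xor_monomial k p n (word_mat k w)"
    using exists_word[OF assms n] by blast
  have "gen_prod k w \<in> carrier (Gamma_hat k)" using w by (auto simp: Gamma_hat_def)
  moreover have "xor_monomial k p n (rho k (gen_prod k w))" using w rho_gen_prod by simp
  then have "f = restrict (clifford_act k (gen_prod k w)) (J2 k)"
    by (simp add: f clifford_act_eq_shift_act cong: restrict_cong)
  ultimately show "f \<in> (\<lambda>a. restrict (clifford_act k a) (J2 k)) ` carrier (Gamma_hat k)" by blast
qed

theorem theorem4p5:
  fixes k :: nat
  assumes "k \<ge> 1"
  shows "(\<forall>a\<in>carrier (Gamma_hat k).
            (\<exists>S\<in>switch_maps k. \<forall>v\<in>J2 k. clifford_act k a v = S v) \<or>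
            (\<exists>S\<in>switch_maps k. \<forall>v\<in>J2 k. clifford_act k a v = i_act k (S v))) \<and>
         (\<exists>\<Phi>. (\<forall>a\<in>carrier (Gamma_hat k).
                  \<Phi> (act_equiv k `` {a}) = restrict (clifford_act k a) (J2 k)) \<and>
               bij_betw \<Phi> (carrier (Gamma_hat k) // act_equiv k) (switch_actions k))"
proof (intro conjI ballI)
  fix a assume "a \<in> carrier (Gamma_hat k)"
  then have "restrict (clifford_act k a) (J2 k) \<in> switch_actions k"
    using clifford_actions_eq[OF assms] by blast
  then obtain S where S: "S \<in> switch_maps k" and
    "restrict (clifford_act k a) (J2 k) = restrict S (J2 k) \<or>
     restrict (clifford_act k a) (J2 k) = restrict (i_act k \<circ> S) (J2 k)"
    by (auto simp: switch_actions_def)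
  then have "(\<forall>v\<in>J2 k. clifford_act k a v = S v) \<or> (\<forall>v\<in>J2 k. clifford_act k a v = i_act k (S v))"
    unfolding restrict_eq_iff by simp
  then show "(\<exists>S\<in>switch_maps k. \<forall>v\<in>J2 k. clifford_act k a v = S v) \<or>
      (\<exists>S\<in>switch_maps k. \<forall>v\<in>J2 k. clifford_act k a v = i_act k (S v))"
    using S by blast
next
  \<comment> \<open>Restriction turns agreement on \<open>J2 k\<close> into equality of functions,
    so the equivalence is the kernel relation of the map from group elements to restricted actions,
    whose image is already known.\<close>
  have "act_equiv k = {(a, b). a \<in> carrier (Gamma_hat k) \<and> b \<in> carrier (Gamma_hat k) \<and>
      restrict (clifford_act k a) (J2 k) = restrict (clifford_act k b) (J2 k)}"
    unfolding act_equiv_def restrict_eq_iff ..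
  from kernel_quotient_bij[OF this]
  show "\<exists>\<Phi>. (\<forall>a\<in>carrier (Gamma_hat k).
          \<Phi> (act_equiv k `` {a}) = restrict (clifford_act k a) (J2 k)) \<and>
        bij_betw \<Phi> (carrier (Gamma_hat k) // act_equiv k) (switch_actions k)"
    unfolding clifford_actions_eq[OF assms] .
qed

end
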